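(* Let $P$ be a Markov transition kernel on a Polish space $H$, and let $\mathcal{G}$ be a set of bounded measurable functions $H\to\mathbb{R}$ which determines measures. Assume that there exists a measurable set $H_0\subset H$ such that for every $(u_0,v_0)\in H_0\times H_0$ and every $\phi\in\mathcal{G}$ there exists $\Gamma=\Gamma(u_0,v_0,\phi)\in\tilde{\mathcal{C}}(\delta_{u_0}P^{\mathbf N},\delta_{v_0}P^{\mathbf N})$ with $\Gamma(\bar D_\phi)>0$. Then there exists at most one ergodic invariant measure $\mu$ for $P$ with $\mu(H_0)>0$. In particular, if $H_0=H$, then there exists at most one, and hence ergodic, invariant measure for $P$.
   Context: $H$ is equipped with its Borel $\sigma$-algebra and $\mathbf N=\{1,2,\dots\}$. For a bounded measurable $\phi:H\to\mathbb R$, $P\phi(u)=\int_H\phi(v)P(u,dv)$; for a probability measure $\nu$ on $H$, $\nu P(A)=\int_H P(u,A)\,\nu(du)$. An invariant measure for $P$ is a (Borel) probability measure $\mu$ on $H$ with $\mu P=\mu$. It is ergodic if $\mu(A)\in\{0,1\}$ for every measurable $A\subset H$ with $P\mathbf 1_A=\mathbf 1_A$ $\mu$-a.e. $H^{\mathbf N}$ is the space of sequences $u=(u_1,u_2,\dots)$ in $H$ with the product $\sigma$-algebra. For a probability measure $\nu$ on $H$, $\nu P^{\mathbf N}$ is the law on $H^{\mathbf N}$ of $(U_1,U_2,\dots)$, where $U_0$ has law $\nu$ and, given $U_{k-1}$, $U_k$ has law $P(U_{k-1},\cdot)$ (a Markov chain with kernel $P$). $\delta_{u_0}$ is the Dirac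 measure at $u_0$. For probability measures $M_1,M_2$ on $H^{\mathbf N}$, $\tilde{\mathcal C}(M_1,M_2)$ is the set of probability measures $\Gamma$ on $H^{\mathbf N}\times H^{\mathbf N}$ such that $\Gamma\Pi_i^{-1}\ll M_i$ (absolute continuity) for $i=1,2$, where $\Pi_1(u,v)=u$, $\Pi_2(u,v)=v$. For bounded measurable $\phi:H\to\mathbb R$, $$\bar D_\phi=\Big\{(u,v)\in H^{\mathbf N}\times H^{\mathbf N}:\ \lim_{n\to\infty}\frac1n\sum_{k=1}^n(\phi(u_k)-\phi(v_k))=0\Big\}.$$ A set $\mathcal G$ of bounded, real-valued, measurable functions on $H$ determines measures if, whenever $\mu_1,\mu_2$ are Borel probability measures on $H$ with $\int\phi\,d\mu_1=\int\phi\,d\mu_2$ for all $\phi\in\mathcal G$, then $\mu_1=\mu_2$. *)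

theory Defs
  imports "HOL-Probability.Probability"
begin

definition markov_kernel :: "('a::topological_space \<Rightarrow> 'a measure) \<Rightarrow> bool" where
  "markov_kernel P \<longleftrightarrow> P \<in> borel \<rightarrow>\<^sub>M prob_algebra borel"

definition kernel_op :: "('a \<Rightarrow> 'a measure) \<Rightarrow> ('a \<Rightarrow> real) \<Rightarrow> 'a \<Rightarrow> real" where
  "kernel_op P \<phi> u = (LINT v|P u. \<phi> v)"

text \<open>The monadic bind \<open>\<mu> \<bind> P\<close> is the measure \<open>\<mu> P\<close>, i.e. \<open>A \<mapsto> \<integral> P u A \<mu>(du)\<close>.\<close>

definition invariant_measure :: "('a::topological_space \<Rightarrow> 'a measure) \<Rightarrow> 'a measure \<Rightarrow> bool" where
  "invariant_measure P \<mu> \<longleftrightarrow> \<mu> \<in> space (prob_algebra borel) \<and> \<mu> \<bind> P = \<mu>"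

definition ergodic_measure :: "('a::topological_space \<Rightarrow> 'a measure) \<Rightarrow> 'a measure \<Rightarrow> bool" where
  "ergodic_measure P \<mu> \<longleftrightarrow> invariant_measure P \<mu> \<and>
     (\<forall>A\<in>sets borel. (AE u in \<mu>. kernel_op P (indicator A) u = indicator A u)
        \<longrightarrow> measure \<mu> A \<in> {0, 1})"

text \<open>Sequences are indexed by \<open>{1..}\<close>; elements of the product space are extensional functions,
  i.e. they take the value \<open>undefined\<close> at the index \<open>0\<close>.\<close>

definition seq_space :: "(nat \<Rightarrow> 'a::topological_space) measure" where
  "seq_space = Pi\<^sub>M {1..} (\<lambda>_. borel)"

text \<open>The conditional law of \<open>U\<^sub>n\<close> given \<open>(U\<^sub>0, \<dots>, U\<^bsub>n-1\<^esub>) = \<omega>\<close>.\<close>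

definition chain_step :: "'a measure \<Rightarrow> ('a \<Rightarrow> 'a measure) \<Rightarrow> nat \<Rightarrow> (nat \<Rightarrow> 'a) \<Rightarrow> 'a measure" where
  "chain_step \<nu> P n \<omega> = (case n of 0 \<Rightarrow> \<nu> | Suc k \<Rightarrow> P (\<omega> k))"

lemma Ionescu_Tulcea_chain_step:
  fixes \<nu> :: "'a::topological_space measure"
  assumes "\<nu> \<in> space (prob_algebra borel)" "markov_kernel P"
  shows "Ionescu_Tulcea (chain_step \<nu> P) (\<lambda>_. borel)"
proof -
  have m: "chain_step \<nu> P i \<in> Pi\<^sub>M {0..<i} (\<lambda>_. borel) \<rightarrow>\<^sub>M prob_algebra borel" for i
  proof (cases i)
    case 0
    then show ?thesis
      using assms(1) by (simp add: chain_step_def[abs_def])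
  next
    case (Suc k)
    have "(\<lambda>\<omega>. \<omega> k) \<in> Pi\<^sub>M {0..<i} (\<lambda>_. borel) \<rightarrow>\<^sub>M (borel :: 'a measure)"
      by (rule measurable_component_singleton) (simp add: Suc)
    from measurable_compose[OF this assms(2)[unfolded markov_kernel_def]] show ?thesis
      by (simp add: chain_step_def[abs_def] Suc)
  qed
  show ?thesis
  proof (rule Ionescu_Tulcea.intro)
    show "chain_step \<nu> P i \<in> Pi\<^sub>M {0..<i} (\<lambda>_. borel) \<rightarrow>\<^sub>M subprob_algebra borel" for i
      by (rule measurable_prob_algebraD[OF m])
    fix i :: nat and \<omega> assume "\<omega> \<in> space (Pi\<^sub>M {0..<i} (\<lambda>_. borel :: 'a measure))"
    from measurable_space[OF m this] show "prob_space (chain_step \<nu> P i \<omega>)"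
      by (simp only: space_prob_algebra mem_Collect_eq)
  qed
qed

text \<open>The law of \<open>(U\<^sub>0, U\<^sub>1, \<dots>)\<close>, where \<open>U\<^sub>0\<close> has law \<open>\<nu>\<close>: the projective limit, by the
  Ionescu-Tulcea theorem, of the finite-dimensional laws generated by the conditional laws
  \<open>chain_step \<nu> P\<close>.\<close>

definition full_chain_law ::
    "'a::topological_space measure \<Rightarrow> ('a \<Rightarrow> 'a measure) \<Rightarrow> (nat \<Rightarrow> 'a) measure" where
  "full_chain_law \<nu> P =
     projective_family.lim UNIV (Ionescu_Tulcea.CI (chain_step \<nu> P) (\<lambda>_. borel)) (\<lambda>_. borel)"

text \<open>The law of \<open>(U\<^sub>1, U\<^sub>2, \<dots>)\<close>; the initial state \<open>U\<^sub>0\<close> is dropped.\<close>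

definition chain_law ::
    "'a::topological_space measure \<Rightarrow> ('a \<Rightarrow> 'a measure) \<Rightarrow> (nat \<Rightarrow> 'a) measure" where
  "chain_law \<nu> P = distr (full_chain_law \<nu> P) seq_space (\<lambda>\<omega>. restrict \<omega> {1..})"

text \<open>In the library, \<open>absolutely_continuous M N\<close> means that \<open>N\<close> is absolutely
  continuous with respect to \<open>M\<close>. The marginals of a generalized
  coupling are only required to be absolutely continuous with respect to \<open>M\<^sub>1\<close> and \<open>M\<^sub>2\<close>.\<close>

definition gen_couplings ::
    "(nat \<Rightarrow> 'a::topological_space) measure \<Rightarrow> (nat \<Rightarrow> 'a) measure
       \<Rightarrow> ((nat \<Rightarrow> 'a) \<times> (nat \<Rightarrow> 'a)) measure set" where
  "gen_couplings M1 M2 =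
     {\<Gamma> \<in> space (prob_algebra (seq_space \<Otimes>\<^sub>M seq_space)).
        absolutely_continuous M1 (distr \<Gamma> seq_space fst) \<and>
        absolutely_continuous M2 (distr \<Gamma> seq_space snd)}"

definition avg_agree_set ::
    "('a::topological_space \<Rightarrow> real) \<Rightarrow> ((nat \<Rightarrow> 'a) \<times> (nat \<Rightarrow> 'a)) set" where
  "avg_agree_set \<phi> = {(u, v) \<in> space (seq_space \<Otimes>\<^sub>M seq_space).
     (\<lambda>n. (1 / real n) * (\<Sum>k=1..n. \<phi> (u k) - \<phi> (v k))) \<longlonglongrightarrow> 0}"

definition bounded_measurable :: "('a::topological_space \<Rightarrow> real) \<Rightarrow> bool" where
  "bounded_measurable \<phi> \<longleftrightarrow> \<phi> \<in> borel_measurable borel \<and> bounded (range \<phi>)"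

definition determines_measures :: "('a::topological_space \<Rightarrow> real) set \<Rightarrow> bool" where
  "determines_measures G \<longleftrightarrow>
     (\<forall>\<mu>1\<in>space (prob_algebra borel). \<forall>\<mu>2\<in>space (prob_algebra borel).
        (\<forall>\<phi>\<in>G. (LINT x|\<mu>1. \<phi> x) = (LINT x|\<mu>2. \<phi> x)) \<longrightarrow> \<mu>1 = \<mu>2)"

end

theory Submission
  imports Defs
begin

text \<open>
The coupling merges the time averages of \<open>\<phi>\<close> over two chains along the full sequence of times, hence along
every subsequence. It therefore suffices to find the limits of both averages along one common
subsequence, and these come from an \<open>L\<^sup>2\<close> law of large numbers.

Write \<open>K\<close> for the Markov operator, \<open>A\<^sub>n \<phi> = (K \<phi> + \<dots> + K\<^sup>n \<phi>) / n\<close>, and \<open>S\<^sub>n\<close> for the time average of \<open>\<phi>\<close> over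
\<open>U\<^sub>1, \<dots>, U\<^sub>n\<close>. Let \<open>\<mu>\<close> be invariant. Since \<open>K\<close> is a contraction of \<open>L\<^sup>2(\<mu>)\<close>, the averages \<open>A\<^sub>n \<phi>\<close>
converge in \<open>L\<^sup>2(\<mu>)\<close> to some \<open>h\<close> with \<open>K h = h\<close> (\<open>mean_ergodic\<close>). Under the stationary chain,
\<open>E (h(U\<^sub>1) - h(U\<^sub>0))\<^sup>2 = 2 \<parallel>h\<parallel>\<^sup>2 - 2 \<langle>h, K h\<rangle> = 0\<close>, so \<open>h\<close> does not change along the chain
(\<open>K_invariant_imp_constant_along_chain\<close>). The second moment of \<open>S\<^sub>n\<close> is a double Cesaro mean of the
correlations \<open>\<langle>\<phi>, K\<^sup>d \<phi>\<rangle>\<close>, and these facts give \<open>E (S\<^sub>n - h(U\<^sub>0))\<^sup>2 \<longlonglongrightarrow> 0\<close>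
(\<open>time_avg_mean_square_limit\<close>). Disintegrating over \<open>U\<^sub>0\<close> and passing to a fast subsequence, for
\<open>\<mu>\<close>-almost every \<open>u\<close> one has \<open>S\<^sub>n \<longlonglongrightarrow> h u\<close> along the subsequence, almost surely for the chain
started at \<open>u\<close> (\<open>AE_time_avg_tendsto\<close>).

For two invariant measures \<open>\<mu>\<^sub>1, \<mu>\<^sub>2\<close> choose one subsequence that serves both. Absolute continuity of the
marginals carries the almost sure limits over to a generalized coupling \<open>\<Gamma>\<close>, and an event of positive
\<open>\<Gamma>\<close>-measure on which the averages merge forces \<open>h\<^sub>1 u = h\<^sub>2 v\<close> for almost all \<open>u, v\<close> in \<open>H0\<close>
(\<open>coupled_invariant_measures_limits_agree\<close>).

If both measures are ergodic, \<open>h\<^sub>i\<close> is the constant \<open>\<integral> \<phi> d\<mu>\<^sub>i\<close>, and the integrals agree because \<open>H0\<close> has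
positive mass for both. If \<open>H0\<close> is the whole space, \<open>h\<^sub>1 u = h\<^sub>2 v\<close> for almost all \<open>u, v\<close> already makes
both functions equal to one constant, so the integrals agree for arbitrary invariant measures. A determining
family then identifies the measures. Finally, a unique invariant measure is ergodic, as conditioning
it on an invariant set of positive mass gives an invariant measure again.
\<close>

section \<open>Sequences, subsequences and integrals\<close>

lemma subsequence_choice:
  assumes "\<And>j::nat. \<exists>N. \<forall>n\<ge>N. Q j n"
  obtains r :: "nat \<Rightarrow> nat" where "strict_mono r" "\<And>j. Q j (r j)"
proof -
  obtain N where N: "\<And>j n. n \<ge> N j \<Longrightarrow> Q j n"
    using assms by metis
  \<comment> \<open>The summand \<open>j\<close> makes \<open>r\<close> strictly increasing, the sum keeps \<open>r j\<close> above \<open>N j\<close>.\<close>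
  define r where "r j = j + (\<Sum>i\<le>j. N i)" for j
  have "strict_mono r"
    by (rule strict_monoI_Suc) (simp add: r_def)
  moreover have "Q j (r j)" for j
  proof (rule N)
    have "N j \<le> (\<Sum>i\<le>j. N i)" by (rule member_le_sum) auto
    then show "N j \<le> r j" by (simp add: r_def)
  qed
  ultimately show thesis by (rule that)
qed

lemma AE_summable_if_summable_integrals:
  fixes f :: "nat \<Rightarrow> 'b \<Rightarrow> real"
  assumes int: "\<And>j. integrable M (f j)"
    and nonneg: "\<And>j x. 0 \<le> f j x"
    and summable: "summable (\<lambda>j. \<integral>x. f j x \<partial>M)"
  shows "AE x in M. summable (\<lambda>j. f j x)"
proof -
  have [measurable]: "f j \<in> borel_measurable M" for j
    using int by auto
  have "(\<integral>\<^sup>+x. (\<Sum>j. ennreal (f j x)) \<partial>M) = (\<Sum>j. \<integral>\<^sup>+x. ennreal (f j x) \<partial>M)"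
    by (rule nn_integral_suminf) simp
  also have "\<dots> = (\<Sum>j. ennreal (\<integral>x. f j x \<partial>M))"
    by (intro suminf_cong nn_integral_eq_integral int) (simp add: nonneg)
  also have "\<dots> = ennreal (\<Sum>j. \<integral>x. f j x \<partial>M)"
    by (intro suminf_ennreal2 summable Bochner_Integration.integral_nonneg nonneg)
  finally have "(\<integral>\<^sup>+x. (\<Sum>j. ennreal (f j x)) \<partial>M) \<noteq> \<infinity>" by simp
  then have "AE x in M. (\<Sum>j. ennreal (f j x)) \<noteq> \<infinity>"
    by (rule nn_integral_PInf_AE[rotated]) simp
  then show ?thesis
    by (auto elim!: eventually_mono intro: summable_suminf_not_top nonneg)
qed

lemma (in prob_space) square_integral_le:
  fixes f :: "'a \<Rightarrow> real"
  assumes "integrable M f" "integrable M (\<lambda>x. (f x)\<^sup>2)"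
  shows "(\<integral>x. f x \<partial>M)\<^sup>2 \<le> (\<integral>x. (f x)\<^sup>2 \<partial>M)"
  using variance_positive[of f] variance_eq[OF assms] by simp

text \<open>The indices below a fixed \<open>N\<close> contribute a bounded amount to the sum; the others at most \<open>n\<^sup>2\<close> times
a small number.\<close>

lemma weighted_Cesaro_null:
  fixes e :: "nat \<Rightarrow> real"
  assumes "e \<longlonglongrightarrow> 0"
  shows "(\<lambda>n. (\<Sum>m<n. real m * e m) / (real n)\<^sup>2) \<longlonglongrightarrow> 0"
proof (rule LIMSEQ_I)
  fix \<epsilon> :: real assume \<epsilon>: "\<epsilon> > 0"
  obtain N where N: "\<And>m. m \<ge> N \<Longrightarrow> \<bar>e m\<bar> < \<epsilon> / 2"
    using LIMSEQ_D[OF assms, of "\<epsilon> / 2"] \<epsilon> by auto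
  define B where "B = (\<Sum>m<N. real m * \<bar>e m\<bar>)"
  have B: "B \<ge> 0" unfolding B_def by (intro sum_nonneg) auto
  obtain N' :: nat where N': "2 * B / \<epsilon> < real N'" using reals_Archimedean2 by blast
  have "norm ((\<Sum>m<n. real m * e m) / (real n)\<^sup>2 - 0) < \<epsilon>" if n: "n \<ge> max 1 N'" for n
  proof -
    have n1: "real n \<ge> 1" and nN: "real N' \<le> real n" using n by auto
    have "\<bar>\<Sum>m<n. real m * e m\<bar> \<le> (\<Sum>m<n. real m * \<bar>e m\<bar>)"
      by (rule order_trans[OF sum_abs]) (simp add: abs_mult)
    also have "\<dots> \<le> (\<Sum>m<n. (if m < N then real m * \<bar>e m\<bar> else 0) + real n * (\<epsilon> / 2))"
    proof (rule sum_mono)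
      fix m assume m: "m \<in> {..<n}"
      show "real m * \<bar>e m\<bar> \<le> (if m < N then real m * \<bar>e m\<bar> else 0) + real n * (\<epsilon> / 2)"
      proof (cases "m < N")
        case False
        then have "\<bar>e m\<bar> \<le> \<epsilon> / 2" using N[of m] by simp
        then have "real m * \<bar>e m\<bar> \<le> real n * (\<epsilon> / 2)" using m by (intro mult_mono) auto
        then show ?thesis using False by simp
      qed (use \<epsilon> in auto)
    qed
    also have "\<dots> = (\<Sum>m<n. if m < N then real m * \<bar>e m\<bar> else 0) + real n * real n * (\<epsilon> / 2)"
      by (simp add: sum.distrib)
    also have "(\<Sum>m<n. if m < N then real m * \<bar>e m\<bar> else 0) = (\<Sum>m\<in>{..<n} \<inter> {..<N}. real m * \<bar>e m\<bar>)"
      by (simp add: sum.inter_restrict)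
    also have "\<dots> \<le> B"
      unfolding B_def by (rule sum_mono2) auto
    finally have "\<bar>\<Sum>m<n. real m * e m\<bar> \<le> B + real n * real n * (\<epsilon> / 2)" by simp
    moreover have "B < real n * real n * (\<epsilon> / 2)"
    proof -
      have "B < real n * (\<epsilon> / 2)" using N' nN \<epsilon> by (auto simp: field_simps intro: less_le_trans)
      also have "\<dots> \<le> real n * (real n * (\<epsilon> / 2))" using n1 \<epsilon> by (simp add: mult_le_cancel_left)
      finally show ?thesis by simp
    qed
    ultimately have "\<bar>\<Sum>m<n. real m * e m\<bar> < \<epsilon> * (real n)\<^sup>2"
      by (simp add: power2_eq_square algebra_simps)
    then show ?thesis using n1 by (simp add: field_simps)
  qed
  then show "\<exists>no. \<forall>n\<ge>no. norm ((\<Sum>m<n. real m * e m) / (real n)\<^sup>2 - 0) < \<epsilon>" by blast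
qed

text \<open>A discrete form of ``\<open>W' = 2 n L\<close> implies \<open>W \<sim> n\<^sup>2 L\<close>''; it turns the limit of the Cesaro means
\<open>x n\<close> of a correlation sequence into that of its double sums.\<close>

lemma quadratic_growth:
  fixes W :: "nat \<Rightarrow> real"
  assumes W0: "W 0 = 0"
    and step: "\<And>n. W (Suc n) = W n + 2 * (real n * x n) + c"
    and x: "x \<longlonglongrightarrow> L"
  shows "(\<lambda>n. W n / (real n)\<^sup>2) \<longlonglongrightarrow> L"
proof -
  have W: "W n = 2 * (\<Sum>m<n. real m * (x m - L)) + real n * (real n - 1) * L + real n * c" for n
    by (induction n) (simp_all add: W0 step algebra_simps)
  have "(\<lambda>n. 2 * ((\<Sum>m<n. real m * (x m - L)) / (real n)\<^sup>2) + (1 - 1 / real n) * L + c * (1 / real n))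
      \<longlonglongrightarrow> 2 * 0 + (1 - 0) * L + c * 0"
    using x by (intro tendsto_intros weighted_Cesaro_null lim_1_over_n) (simp add: LIM_zero_iff)
  then have "(\<lambda>n. 2 * ((\<Sum>m<n. real m * (x m - L)) / (real n)\<^sup>2) + (1 - 1 / real n) * L + c * (1 / real n))
      \<longlonglongrightarrow> L" by simp
  then show ?thesis
  proof (rule Lim_transform_eventually)
    show "\<forall>\<^sub>F n in sequentially.
       2 * ((\<Sum>m<n. real m * (x m - L)) / (real n)\<^sup>2) + (1 - 1 / real n) * L + c * (1 / real n)
       = W n / (real n)\<^sup>2"
      using eventually_gt_at_top[of 0]
      by eventually_elim (auto simp: W field_simps power2_eq_square)
  qed
qed

text \<open>Completeness of \<open>L\<^sup>2\<close>, in the form that keeps a common pointwise bound: a subsequence with geometrically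
decreasing \<open>L\<^sup>1\<close> increments converges almost everywhere, and dominated convergence identifies its
pointwise limit with the \<open>L\<^sup>2\<close> limit.\<close>

lemma (in prob_space) bounded_L2_Cauchy_limit:
  fixes g :: "nat \<Rightarrow> 'a \<Rightarrow> real"
  assumes g[measurable]: "\<And>n. g n \<in> borel_measurable M" and C: "\<And>n x. \<bar>g n x\<bar> \<le> C"
    and Cauchy: "\<And>\<epsilon>. \<epsilon> > 0 \<Longrightarrow> \<exists>N. \<forall>n\<ge>N. \<forall>m\<ge>N. (\<integral>x. (g m x - g n x)\<^sup>2 \<partial>M) < \<epsilon>"
  obtains h where "h \<in> borel_measurable M" "\<And>x. \<bar>h x\<bar> \<le> C"
    "(\<lambda>n. \<integral>x. (g n x - h x)\<^sup>2 \<partial>M) \<longlonglongrightarrow> 0"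
proof -
  have C0: "C \<ge> 0" using C[of 0 undefined] by linarith
  have diff_le: "\<bar>a - b\<bar> \<le> 2 * C" if "\<bar>a\<bar> \<le> C" "\<bar>b\<bar> \<le> C" for a b
    using that by linarith
  have sq_le: "(a - b)\<^sup>2 \<le> (2 * C)\<^sup>2" if "\<bar>a\<bar> \<le> C" "\<bar>b\<bar> \<le> C" for a b
    using diff_le[OF that] C0 by (metis abs_le_square_iff abs_of_nonneg mult_nonneg_nonneg zero_le_numeral)
  have "\<exists>N. \<forall>n\<ge>N. \<forall>m\<ge>n. (\<integral>x. (g m x - g n x)\<^sup>2 \<partial>M) < (1/4) ^ j" for j :: nat
    using Cauchy[of "(1/4) ^ j"] by (meson dual_order.trans zero_less_divide_1_iff zero_less_numeral zero_less_power)
  then obtain r where r: "strict_mono r" "\<And>j. \<forall>m\<ge>r j. (\<integral>x. (g m x - g (r j) x)\<^sup>2 \<partial>M) < (1/4) ^ j"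
    using subsequence_choice[of "\<lambda>j n. \<forall>m\<ge>n. (\<integral>x. (g m x - g n x)\<^sup>2 \<partial>M) < (1/4) ^ j"] by blast
  define d where "d j x = \<bar>g (r (Suc j)) x - g (r j) x\<bar>" for j x
  have int_d: "integrable M (d j)" for j
    unfolding d_def by (rule integrable_const_bound[of _ "2 * C"]) (auto intro: diff_le C)
  have d_le: "(\<integral>x. d j x \<partial>M) \<le> (1/2) ^ j" for j
  proof (rule power2_le_imp_le)
    have "(\<integral>x. d j x \<partial>M)\<^sup>2 \<le> (\<integral>x. (d j x)\<^sup>2 \<partial>M)"
    proof (rule square_integral_le[OF int_d])
      show "integrable M (\<lambda>x. (d j x)\<^sup>2)"
        unfolding d_def power2_abs
        by (rule integrable_const_bound[of _ "(2 * C)\<^sup>2"])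
          (use sq_le[OF C C] in \<open>auto simp: power_mult_distrib\<close>)
    qed
    also have "\<dots> < (1/4) ^ j"
      unfolding d_def power2_abs using r by (simp add: strict_mono_less_eq)
    also have "(1/4 :: real) ^ j = ((1/2) ^ j)\<^sup>2"
      by (simp add: power2_eq_square power_mult_distrib[symmetric])
    finally show "(\<integral>x. d j x \<partial>M)\<^sup>2 \<le> ((1/2) ^ j)\<^sup>2" by simp
  qed simp
  have "AE x in M. summable (\<lambda>j. d j x)"
  proof (rule AE_summable_if_summable_integrals[OF int_d])
    show "summable (\<lambda>j. \<integral>x. d j x \<partial>M)"
      by (rule summable_comparison_test'[OF summable_geometric[of "1/2"], of 0])
        (use d_le in \<open>auto simp: d_def\<close>)
  qed (simp add: d_def)
  then have conv: "AE x in M. convergent (\<lambda>j. g (r j) x)"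
  proof eventually_elim
    case (elim x)
    then have "summable (\<lambda>j. g (r (Suc j)) x - g (r j) x)"
      unfolding d_def by (rule summable_rabs_cancel)
    then have "(\<lambda>n. \<Sum>j<n. g (r (Suc j)) x - g (r j) x) \<longlonglongrightarrow> (\<Sum>j. g (r (Suc j)) x - g (r j) x)"
      by (rule summable_LIMSEQ)
    then have "(\<lambda>n. g (r n) x - g (r 0) x) \<longlonglongrightarrow> (\<Sum>j. g (r (Suc j)) x - g (r j) x)"
      by (simp only: sum_lessThan_telescope[of "\<lambda>j. g (r j) x"])
    from tendsto_add[OF this tendsto_const[of "g (r 0) x"]] show ?case
      by (auto simp: convergent_def)
  qed
  \<comment> \<open>The value \<open>0\<close> off the convergence set keeps \<open>h\<close> measurable and within the bound \<open>C\<close>.\<close>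
  define h where "h x = (if Cauchy (\<lambda>j. g (r j) x) then lim (\<lambda>j. g (r j) x) else 0)" for x
  have h[measurable]: "h \<in> borel_measurable M"
    unfolding h_def[abs_def] by measurable
  have lim_h: "(\<lambda>j. g (r j) x) \<longlonglongrightarrow> h x" if "convergent (\<lambda>j. g (r j) x)" for x
    using that by (simp add: h_def Cauchy_convergent_iff convergent_LIMSEQ_iff)
  have hC: "\<bar>h x\<bar> \<le> C" for x
  proof (cases "Cauchy (\<lambda>j. g (r j) x)")
    case True
    then have "(\<lambda>j. \<bar>g (r j) x\<bar>) \<longlonglongrightarrow> \<bar>h x\<bar>"
      by (intro tendsto_rabs lim_h) (simp add: Cauchy_convergent_iff)
    then show ?thesis
      by (rule LIMSEQ_le_const2) (use C in auto)
  qed (simp add: h_def C0)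
  have "(\<lambda>n. \<integral>x. (g n x - h x)\<^sup>2 \<partial>M) \<longlonglongrightarrow> 0"
  proof (rule LIMSEQ_I)
    fix \<epsilon> :: real assume "\<epsilon> > 0"
    then obtain N where N: "\<And>n m. n \<ge> N \<Longrightarrow> m \<ge> N \<Longrightarrow> (\<integral>x. (g m x - g n x)\<^sup>2 \<partial>M) < \<epsilon> / 2"
      using Cauchy[of "\<epsilon> / 2"] by auto
    have "(\<integral>x. (g n x - h x)\<^sup>2 \<partial>M) \<le> \<epsilon> / 2" if n: "n \<ge> N" for n
    proof (rule LIMSEQ_le_const2)
      show "(\<lambda>j. \<integral>x. (g n x - g (r j) x)\<^sup>2 \<partial>M) \<longlonglongrightarrow> (\<integral>x. (g n x - h x)\<^sup>2 \<partial>M)"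
      proof (rule integral_dominated_convergence[where w="\<lambda>_. (2 * C)\<^sup>2"])
        show "AE x in M. (\<lambda>j. (g n x - g (r j) x)\<^sup>2) \<longlonglongrightarrow> (g n x - h x)\<^sup>2"
          using conv by eventually_elim (intro tendsto_intros lim_h)
        show "AE x in M. norm ((g n x - g (r j) x)\<^sup>2) \<le> (2 * C)\<^sup>2" for j
          using sq_le[OF C C] by (auto simp: power_mult_distrib)
      qed auto
      have "(\<integral>x. (g n x - g (r j) x)\<^sup>2 \<partial>M) \<le> \<epsilon> / 2" if "j \<ge> N" for j
        using N[of "r j" n] n that strict_mono_imp_increasing[OF r(1), of j] by simp
      then show "\<exists>N. \<forall>j\<ge>N. (\<integral>x. (g n x - g (r j) x)\<^sup>2 \<partial>M) \<le> \<epsilon> / 2" by blast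
    qed
    then have "norm ((\<integral>x. (g n x - h x)\<^sup>2 \<partial>M) - 0) < \<epsilon>" if "n \<ge> N" for n
      using \<open>\<epsilon> > 0\<close> that by fastforce
    then show "\<exists>no. \<forall>n\<ge>no. norm ((\<integral>x. (g n x - h x)\<^sup>2 \<partial>M) - 0) < \<epsilon>" by blast
  qed
  with h hC show thesis by (rule that)
qed

section \<open>Bounded measurable functions\<close>

lemma bounded_measurableE:
  assumes "bounded_measurable f"
  obtains C where "C \<ge> 0" "\<And>x. \<bar>f x\<bar> \<le> C"
  using assms unfolding bounded_measurable_def bounded_iff
  by (metis abs_ge_zero order_trans rangeI real_norm_def)

lemma bounded_measurableI:
  assumes "f \<in> borel_measurable borel" "\<And>x. \<bar>f x\<bar> \<le> C"
  shows "bounded_measurable f"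
  using assms by (auto simp: bounded_measurable_def bounded_iff)

lemma bounded_measurableD[measurable_dest]: "bounded_measurable f \<Longrightarrow> f \<in> borel_measurable borel"
  by (simp add: bounded_measurable_def)

named_theorems bounded_measurable_intros

lemma bounded_measurable_const[bounded_measurable_intros]: "bounded_measurable (\<lambda>x. c)"
  by (rule bounded_measurableI[of _ "\<bar>c\<bar>"]) auto

lemma bounded_measurable_indicator[bounded_measurable_intros]: "A \<in> sets borel \<Longrightarrow> bounded_measurable (indicator A)"
  by (rule bounded_measurableI[of _ 1]) (auto simp: indicator_def)

lemma bounded_measurable_add[bounded_measurable_intros]:
  assumes "bounded_measurable f" "bounded_measurable g"
  shows "bounded_measurable (\<lambda>x. f x + g x)"
proof -
  obtain C D where "\<And>x. \<bar>f x\<bar> \<le> C" "\<And>x. \<bar>g x\<bar> \<le> D"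
    using assms by (metis bounded_measurableE)
  then have "\<bar>f x + g x\<bar> \<le> C + D" for x
    by (rule order_trans[OF abs_triangle_ineq add_mono])
  then show ?thesis using assms by (intro bounded_measurableI) auto
qed

lemma bounded_measurable_mult[bounded_measurable_intros]:
  assumes "bounded_measurable f" "bounded_measurable g"
  shows "bounded_measurable (\<lambda>x. f x * g x)"
proof -
  obtain C D where "C \<ge> 0" "\<And>x. \<bar>f x\<bar> \<le> C" "\<And>x. \<bar>g x\<bar> \<le> D"
    using assms by (metis bounded_measurableE)
  then have "\<bar>f x * g x\<bar> \<le> C * D" for x by (simp add: abs_mult mult_mono)
  then show ?thesis using assms by (intro bounded_measurableI) auto
qed

lemma bounded_measurable_diff[bounded_measurable_intros]:
  assumes "bounded_measurable f" "bounded_measurable g"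
  shows "bounded_measurable (\<lambda>x. f x - g x)"
  using bounded_measurable_add[OF assms(1) bounded_measurable_mult[OF bounded_measurable_const[of "-1"] assms(2)]] by simp

lemma bounded_measurable_divide[bounded_measurable_intros]: "bounded_measurable f \<Longrightarrow> bounded_measurable (\<lambda>x. f x / c)"
  using bounded_measurable_mult[OF _ bounded_measurable_const[of "1 / c"], of f] by simp

lemma bounded_measurable_power2[bounded_measurable_intros]: "bounded_measurable f \<Longrightarrow> bounded_measurable (\<lambda>x. (f x)\<^sup>2)"
  by (simp add: power2_eq_square bounded_measurable_intros)

lemma bounded_measurable_sum[bounded_measurable_intros]:
  "(\<And>i. i \<in> I \<Longrightarrow> bounded_measurable (f i)) \<Longrightarrow> bounded_measurable (\<lambda>x. \<Sum>i\<in>I. f i x)"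
  by (induction I rule: infinite_finite_induct) (auto intro!: bounded_measurable_intros)

lemma integrable_bounded_measurable:
  assumes "\<mu> \<in> space (prob_algebra borel)" "bounded_measurable f"
  shows "integrable \<mu> f"
proof -
  interpret prob_space \<mu> using assms(1) by (simp add: space_prob_algebra)
  obtain C where "\<And>x. \<bar>f x\<bar> \<le> C" using assms(2) by (metis bounded_measurableE)
  moreover have "f \<in> borel_measurable \<mu>"
    using assms measurable_cong_sets[of \<mu> borel borel borel]
    by (auto simp: space_prob_algebra bounded_measurable_def)
  ultimately show ?thesis by (intro integrable_const_bound[of _ C]) auto
qed

section \<open>The Markov operator and its Cesaro averages\<close>

locale markov_chain =
  fixes P :: "'a::topological_space \<Rightarrow> 'a measure"
  assumes kernel: "markov_kernel P"
begin

abbreviation K :: "('a \<Rightarrow> real) \<Rightarrow> 'a \<Rightarrow> real" where "K \<equiv> kernel_op P"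

lemma measurable_kernel[measurable]: "P \<in> borel \<rightarrow>\<^sub>M subprob_algebra borel"
  using kernel unfolding markov_kernel_def by (rule measurable_prob_algebraD)

lemma kernel_in_prob_algebra: "P u \<in> space (prob_algebra borel)"
  using kernel measurable_space[of P borel "prob_algebra borel" u] by (simp add: markov_kernel_def)

lemma prob_space_kernel: "prob_space (P u)"
  using kernel_in_prob_algebra by (simp add: space_prob_algebra)

lemma integrable_kernel: "bounded_measurable f \<Longrightarrow> integrable (P u) f"
  by (rule integrable_bounded_measurable[OF kernel_in_prob_algebra])

lemma K_abs_le:
  assumes "bounded_measurable f" "\<And>x. \<bar>f x\<bar> \<le> C"
  shows "\<bar>K f u\<bar> \<le> C"
proof -
  interpret prob_space "P u" by (rule prob_space_kernel)
  have "\<bar>K f u\<bar> \<le> (\<integral>v. \<bar>f v\<bar> \<partial>P u)"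
    unfolding kernel_op_def by (rule integral_abs_bound)
  also have "\<dots> \<le> (\<integral>v. C \<partial>P u)"
    by (intro integral_mono integrable_abs integrable_kernel assms integrable_const)
  also have "\<dots> = C" by (simp add: prob_space)
  finally show ?thesis .
qed

lemma bounded_measurable_K[bounded_measurable_intros]:
  assumes "bounded_measurable f"
  shows "bounded_measurable (K f)"
proof -
  obtain C where C: "\<And>x. \<bar>f x\<bar> \<le> C" using assms by (metis bounded_measurableE)
  have [measurable]: "f \<in> borel_measurable borel" using assms by (rule bounded_measurableD)
  have "K f \<in> borel_measurable borel" unfolding kernel_op_def[abs_def] by measurable
  then show ?thesis using K_abs_le[OF assms C] by (rule bounded_measurableI)
qed

lemma K_add: "bounded_measurable f \<Longrightarrow> bounded_measurable g \<Longrightarrow> K (\<lambda>x. f x + g x) = (\<lambda>u. K f u + K g u)"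
  unfolding kernel_op_def by (intro ext Bochner_Integration.integral_add integrable_kernel)

lemma K_diff: "bounded_measurable f \<Longrightarrow> bounded_measurable g \<Longrightarrow> K (\<lambda>x. f x - g x) = (\<lambda>u. K f u - K g u)"
  unfolding kernel_op_def by (intro ext Bochner_Integration.integral_diff integrable_kernel)

lemma K_divide: "K (\<lambda>x. f x / c) = (\<lambda>u. K f u / c)"
  unfolding kernel_op_def by simp

lemma K_sum:
  "(\<And>i. i \<in> I \<Longrightarrow> bounded_measurable (f i)) \<Longrightarrow> K (\<lambda>x. \<Sum>i\<in>I. f i x) = (\<lambda>u. \<Sum>i\<in>I. K (f i) u)"
  unfolding kernel_op_def by (intro ext Bochner_Integration.integral_sum integrable_kernel)

text \<open>Jensen's inequality; with the invariance of \<open>\<mu>\<close> it makes \<open>K\<close> a contraction of \<open>L\<^sup>2(\<mu>)\<close>.\<close>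

lemma K_square_le: "bounded_measurable f \<Longrightarrow> (K f u)\<^sup>2 \<le> K (\<lambda>x. (f x)\<^sup>2) u"
  unfolding kernel_op_def
  by (intro prob_space.square_integral_le prob_space_kernel integrable_kernel bounded_measurable_intros)

abbreviation Kn :: "nat \<Rightarrow> ('a \<Rightarrow> real) \<Rightarrow> 'a \<Rightarrow> real" where "Kn n \<equiv> K ^^ n"

lemma bounded_measurable_Kn[bounded_measurable_intros]: "bounded_measurable f \<Longrightarrow> bounded_measurable (Kn n f)"
  by (induction n) (auto intro: bounded_measurable_intros)

lemma Kn_abs_le: "bounded_measurable f \<Longrightarrow> (\<And>x. \<bar>f x\<bar> \<le> C) \<Longrightarrow> \<bar>Kn n f u\<bar> \<le> C"
  by (induction n arbitrary: u) (auto intro!: K_abs_le bounded_measurable_intros)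

lemma Kn_add: "bounded_measurable f \<Longrightarrow> bounded_measurable g \<Longrightarrow> Kn n (\<lambda>x. f x + g x) = (\<lambda>u. Kn n f u + Kn n g u)"
  by (induction n) (simp_all add: K_add bounded_measurable_intros)

lemma Kn_divide: "Kn n (\<lambda>x. f x / c) = (\<lambda>u. Kn n f u / c)"
  by (induction n) (simp_all add: K_divide)

lemma Kn_sum:
  "(\<And>i. i \<in> I \<Longrightarrow> bounded_measurable (f i)) \<Longrightarrow> Kn n (\<lambda>x. \<Sum>i\<in>I. f i x) = (\<lambda>u. \<Sum>i\<in>I. Kn n (f i) u)"
  by (induction n) (simp_all add: K_sum bounded_measurable_intros)

text \<open>The sum starts at \<open>k = 1\<close>, the first time of the paths, so that \<open>avg n f u\<close> is the mean of the time average of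
\<open>f\<close> for the chain started at \<open>u\<close>. For \<open>n = 0\<close>, division by zero gives the value \<open>0\<close>.\<close>

definition avg :: "nat \<Rightarrow> ('a \<Rightarrow> real) \<Rightarrow> 'a \<Rightarrow> real" where
  "avg n f u = (\<Sum>k=1..n. Kn k f u) / real n"

lemma bounded_measurable_avg[bounded_measurable_intros]: "bounded_measurable f \<Longrightarrow> bounded_measurable (avg n f)"
  unfolding avg_def[abs_def] by (intro bounded_measurable_intros)

lemma avg_abs_le:
  assumes "bounded_measurable f" "\<And>x. \<bar>f x\<bar> \<le> C"
  shows "\<bar>avg n f u\<bar> \<le> C"
proof (cases "n = 0")
  case True
  have "0 \<le> C" using assms(2)[of u] by linarith
  then show ?thesis using True by (simp add: avg_def)
next
  case False
  have "\<bar>\<Sum>k=1..n. Kn k f u\<bar> \<le> (\<Sum>k=1..n. C)"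
    by (intro order_trans[OF sum_abs] sum_mono Kn_abs_le assms)
  then show ?thesis using False by (simp add: avg_def field_simps)
qed

lemma avg_add: "bounded_measurable f \<Longrightarrow> bounded_measurable g \<Longrightarrow> avg n (\<lambda>x. f x + g x) u = avg n f u + avg n g u"
  by (simp add: avg_def Kn_add sum.distrib add_divide_distrib)

lemma avg_divide: "avg n (\<lambda>x. f x / c) u = avg n f u / c"
  by (simp add: avg_def Kn_divide sum_divide_distrib[symmetric])

lemma avg_sum:
  "(\<And>i. i \<in> I \<Longrightarrow> bounded_measurable (f i)) \<Longrightarrow> avg n (\<lambda>x. \<Sum>i\<in>I. f i x) u = (\<Sum>i\<in>I. avg n (f i) u)"
  by (simp add: avg_def Kn_sum sum_divide_distrib[symmetric] sum.swap[of _ I])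

lemma K_avg: "bounded_measurable f \<Longrightarrow> K (avg n f) = avg n (K f)"
  unfolding avg_def[abs_def] by (simp add: K_divide K_sum bounded_measurable_intros funpow_swap1)

lemma avg_K_close:
  assumes "bounded_measurable f" "\<And>x. \<bar>f x\<bar> \<le> C"
  shows "\<bar>avg n (K f) u - avg n f u\<bar> \<le> 2 * C / real n"
proof -
  have "(\<Sum>k=1..n. Kn k (K f) u) - (\<Sum>k=1..n. Kn k f u) = (\<Sum>k=1..n. Kn (Suc k) f u - Kn k f u)"
    by (simp add: sum_subtractf funpow_swap1)
  also have "\<dots> = Kn (Suc n) f u - Kn 1 f u"
    by (subst sum_Suc_diff) simp_all
  finally have "avg n (K f) u - avg n f u = (Kn (Suc n) f u - Kn 1 f u) / real n"
    unfolding avg_def by (metis diff_divide_distrib)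
  moreover have "\<bar>Kn (Suc n) f u - Kn 1 f u\<bar> \<le> 2 * C"
    using Kn_abs_le[OF assms, of "Suc n" u] Kn_abs_le[OF assms, of 1 u] by linarith
  ultimately show ?thesis by (simp add: divide_right_mono)
qed

lemma avg_Kn_close:
  assumes f: "bounded_measurable f" "\<And>x. \<bar>f x\<bar> \<le> C"
  shows "\<bar>avg n (Kn k f) u - avg n f u\<bar> \<le> real k * (2 * C) / real n"
proof (induction k)
  case (Suc k)
  have "\<bar>avg n (K (Kn k f)) u - avg n (Kn k f) u\<bar> \<le> 2 * C / real n"
    by (intro avg_K_close bounded_measurable_intros f Kn_abs_le)
  with Suc show ?case by (simp add: algebra_simps add_divide_distrib)
qed simp

text \<open>Averaging over a long window is insensitive to a prior average over a short one, uniformly in \<open>u\<close>: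
shifting by one step changes only the two end terms of the sum.\<close>

lemma avg_avg_close:
  assumes f: "bounded_measurable f" "\<And>x. \<bar>f x\<bar> \<le> C" and m: "m > 0"
  shows "\<bar>avg n (avg m f) u - avg n f u\<bar> \<le> real m * (2 * C) / real n"
proof -
  have C: "C \<ge> 0" using f(2)[of u] by linarith
  have "avg n (avg m f) u = (\<Sum>k=1..m. avg n (Kn k f) u) / real m"
    unfolding avg_def[of m, abs_def] by (simp add: avg_divide avg_sum bounded_measurable_intros f)
  then have "avg n (avg m f) u - avg n f u = (\<Sum>k=1..m. avg n (Kn k f) u - avg n f u) / real m"
    using m by (simp add: sum_subtractf field_simps)
  moreover have "\<bar>\<Sum>k=1..m. avg n (Kn k f) u - avg n f u\<bar> \<le> (\<Sum>k=1..m. real m * (2 * C) / real n)"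
  proof (rule order_trans[OF sum_abs sum_mono])
    fix k assume "k \<in> {1..m}"
    then have "real k * (2 * C) / real n \<le> real m * (2 * C) / real n"
      using C by (intro divide_right_mono mult_right_mono) auto
    then show "\<bar>avg n (Kn k f) u - avg n f u\<bar> \<le> real m * (2 * C) / real n"
      using avg_Kn_close[OF f, of n k u] by linarith
  qed
  then have "\<bar>\<Sum>k=1..m. avg n (Kn k f) u - avg n f u\<bar> / real m \<le> real m * (2 * C) / real n"
    using m by (subst pos_divide_le_eq) (simp_all add: mult.commute)
  ultimately show ?thesis by (simp add: abs_divide)
qed

end

section \<open>The mean ergodic theorem for a stationary chain\<close>

locale stationary_chain = markov_chain +
  fixes \<mu> :: "'a measure"
  assumes invariant: "invariant_measure P \<mu>"
begin

lemma \<mu>_prob_algebra: "\<mu> \<in> space (prob_algebra borel)"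
  using invariant by (simp add: invariant_measure_def)

lemma sets_\<mu>[measurable_cong, simp]: "sets \<mu> = sets borel"
  using \<mu>_prob_algebra by (simp add: space_prob_algebra)

lemma space_\<mu>[simp]: "space \<mu> = UNIV"
  using sets_eq_imp_space_eq[OF sets_\<mu>] by simp

sublocale prob_space \<mu>
  using \<mu>_prob_algebra by (simp add: space_prob_algebra)

lemma prob_UNIV: "prob UNIV = 1"
  using prob_space by simp

lemma integrable_stationary: "bounded_measurable f \<Longrightarrow> integrable \<mu> f"
  by (rule integrable_bounded_measurable[OF \<mu>_prob_algebra])

lemma measurable_stationary: "bounded_measurable f \<Longrightarrow> f \<in> borel_measurable \<mu>"
  using integrable_stationary by auto

lemma integral_K:
  assumes "bounded_measurable f"
  shows "(\<integral>u. K f u \<partial>\<mu>) = (\<integral>u. f u \<partial>\<mu>)"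
proof -
  obtain C where C: "\<And>x. \<bar>f x\<bar> \<le> C" using assms by (metis bounded_measurableE)
  have "integral\<^sup>L (\<mu> \<bind> P) f = (\<integral>u. integral\<^sup>L (P u) f \<partial>\<mu>)"
    by (rule integral_bind[where K=borel and B=C and B'=1])
      (auto simp: bounded_measurableD[OF assms] C finite_measure_axioms
        prob_space.emeasure_space_1[OF prob_space_kernel])
  then show ?thesis
    using invariant by (simp add: invariant_measure_def kernel_op_def)
qed

lemma integral_Kn: "bounded_measurable f \<Longrightarrow> (\<integral>u. Kn n f u \<partial>\<mu>) = (\<integral>u. f u \<partial>\<mu>)"
  by (induction n) (simp_all add: integral_K bounded_measurable_intros)

lemma integral_avg: "bounded_measurable f \<Longrightarrow> n > 0 \<Longrightarrow> (\<integral>u. avg n f u \<partial>\<mu>) = (\<integral>u. f u \<partial>\<mu>)"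
  by (simp add: avg_def integral_Kn Bochner_Integration.integral_sum integrable_stationary bounded_measurable_intros)

lemma integral_K_square_le:
  assumes "bounded_measurable f"
  shows "(\<integral>u. (K f u)\<^sup>2 \<partial>\<mu>) \<le> (\<integral>u. (f u)\<^sup>2 \<partial>\<mu>)"
proof -
  have "(\<integral>u. (K f u)\<^sup>2 \<partial>\<mu>) \<le> (\<integral>u. K (\<lambda>x. (f x)\<^sup>2) u \<partial>\<mu>)"
    by (intro integral_mono integrable_stationary bounded_measurable_intros assms K_square_le)
  also have "\<dots> = (\<integral>u. (f u)\<^sup>2 \<partial>\<mu>)"
    by (intro integral_K bounded_measurable_intros assms)
  finally show ?thesis .
qed

lemma integral_Kn_square_le:
  "bounded_measurable f \<Longrightarrow> (\<integral>u. (Kn n f u)\<^sup>2 \<partial>\<mu>) \<le> (\<integral>u. (f u)\<^sup>2 \<partial>\<mu>)"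
proof (induction n)
  case (Suc n)
  have "(\<integral>u. (K (Kn n f) u)\<^sup>2 \<partial>\<mu>) \<le> (\<integral>u. (Kn n f u)\<^sup>2 \<partial>\<mu>)"
    by (intro integral_K_square_le bounded_measurable_intros Suc)
  with Suc show ?case by simp
qed simp

lemma integral_avg_square_le:
  assumes f: "bounded_measurable f"
  shows "(\<integral>u. (avg n f u)\<^sup>2 \<partial>\<mu>) \<le> (\<integral>u. (f u)\<^sup>2 \<partial>\<mu>)"
proof (cases "n = 0")
  case False
  have "(avg n f u)\<^sup>2 \<le> (\<Sum>k=1..n. (Kn k f u)\<^sup>2) / real n" for u
  proof -
    have "(\<Sum>k=1..n. Kn k f u)\<^sup>2 \<le> real n * (\<Sum>k=1..n. (Kn k f u)\<^sup>2)"
      using sum_squared_le_sum_of_squares[of "\<lambda>k. Kn k f u" "{1..n}"] by (simp add: mult.commute)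
    then show ?thesis using False by (simp add: avg_def field_simps power2_eq_square)
  qed
  then have "(\<integral>u. (avg n f u)\<^sup>2 \<partial>\<mu>) \<le> (\<integral>u. (\<Sum>k=1..n. (Kn k f u)\<^sup>2) / real n \<partial>\<mu>)"
    by (intro integral_mono integrable_stationary bounded_measurable_intros f) auto
  also have "\<dots> = (\<Sum>k=1..n. \<integral>u. (Kn k f u)\<^sup>2 \<partial>\<mu>) / real n"
    by (simp add: Bochner_Integration.integral_sum integrable_stationary bounded_measurable_intros f)
  also have "\<dots> \<le> (\<Sum>k=1..n. \<integral>u. (f u)\<^sup>2 \<partial>\<mu>) / real n"
    by (intro divide_right_mono sum_mono integral_Kn_square_le f) auto
  finally show ?thesis using False by simp
qed (simp add: avg_def)

lemma integral_square_le_bound: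
  assumes f: "bounded_measurable f" and g: "bounded_measurable g"
    and C: "\<And>u. \<bar>f u\<bar> \<le> C" "\<And>u. \<bar>g u\<bar> \<le> C" and d: "\<And>u. \<bar>f u - g u\<bar> \<le> d"
  shows "(\<integral>u. (f u)\<^sup>2 \<partial>\<mu>) \<le> (\<integral>u. (g u)\<^sup>2 \<partial>\<mu>) + 2 * C * d"
proof -
  have "(f u)\<^sup>2 \<le> (g u)\<^sup>2 + 2 * C * d" for u
  proof -
    have "(f u)\<^sup>2 - (g u)\<^sup>2 \<le> \<bar>f u + g u\<bar> * \<bar>f u - g u\<bar>"
      by (simp add: power2_eq_square abs_mult[symmetric] algebra_simps abs_ge_self)
    also have "\<dots> \<le> (2 * C) * d"
      using C(1)[of u] C(2)[of u] d[of u] by (intro mult_mono) auto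
    finally show ?thesis by simp
  qed
  then have "(\<integral>u. (f u)\<^sup>2 \<partial>\<mu>) \<le> (\<integral>u. (g u)\<^sup>2 + 2 * C * d \<partial>\<mu>)"
    by (intro integral_mono integrable_stationary bounded_measurable_intros f g)
  also have "\<dots> = (\<integral>u. (g u)\<^sup>2 \<partial>\<mu>) + 2 * C * d"
    by (simp add: integrable_stationary bounded_measurable_intros g prob_UNIV)
  finally show ?thesis .
qed

text \<open>Up to an error of order \<open>1/N\<close>, the norm of \<open>A\<^sub>N \<phi>\<close> is at most that of any bounded \<open>f\<close> whose averages
are asymptotically those of \<open>\<phi>\<close>. It will be applied to the averages of \<open>\<phi>\<close> and to their midpoints.\<close>

lemma avg_asymptotically_minimal:
  assumes \<phi>: "bounded_measurable \<phi>" "\<And>u. \<bar>\<phi> u\<bar> \<le> C"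
    and f: "bounded_measurable f" "\<And>u. \<bar>f u\<bar> \<le> C"
    and close: "\<And>N u. \<bar>avg N \<phi> u - avg N f u\<bar> \<le> B / real N"
  shows "(\<integral>u. (avg N \<phi> u)\<^sup>2 \<partial>\<mu>) \<le> (\<integral>u. (f u)\<^sup>2 \<partial>\<mu>) + 2 * C * (B / real N)"
proof -
  have "(\<integral>u. (avg N \<phi> u)\<^sup>2 \<partial>\<mu>) \<le> (\<integral>u. (avg N f u)\<^sup>2 \<partial>\<mu>) + 2 * C * (B / real N)"
    by (intro integral_square_le_bound bounded_measurable_intros avg_abs_le \<phi> f close)
  with integral_avg_square_le[OF f(1), of N] show ?thesis by simp
qed

text \<open>The Riesz minimisation argument. The squared norms of \<open>A\<^sub>n \<phi>\<close> converge to their infimum \<open>\<alpha>\<close>, while the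
midpoint of any two averages has squared norm at least \<open>\<alpha>\<close>; the parallelogram identity then bounds
the distance of the two.\<close>

lemma avg_L2_Cauchy:
  assumes \<phi>: "bounded_measurable \<phi>" and \<epsilon>: "\<epsilon> > 0"
  shows "\<exists>N. \<forall>n\<ge>N. \<forall>m\<ge>N. (\<integral>u. (avg m \<phi> u - avg n \<phi> u)\<^sup>2 \<partial>\<mu>) < \<epsilon>"
proof -
  obtain C where C: "C \<ge> 0" "\<And>x. \<bar>\<phi> x\<bar> \<le> C" using \<phi> by (metis bounded_measurableE)
  note [bounded_measurable_intros] = \<phi>
  define a where "a n = (\<integral>u. (avg n \<phi> u)\<^sup>2 \<partial>\<mu>)" for n
  define \<alpha> where "\<alpha> = (INF n\<in>{1..}. a n)"
  have bdd: "bdd_below (a ` {1..})"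
    by (rule bdd_belowI[of _ 0]) (auto simp: a_def)
  have \<alpha>_le: "\<alpha> \<le> a n" if "n \<ge> 1" for n
    unfolding \<alpha>_def using that by (intro cINF_lower[OF bdd]) auto
  have le_of_eventually_close: "x \<le> y" if "\<And>N. N \<ge> 1 \<Longrightarrow> x \<le> y + 2 * C * (B / real N)" for x y B
  proof (rule LIMSEQ_le_const)
    show "(\<lambda>N. y + 2 * C * B * (1 / real N)) \<longlonglongrightarrow> y"
      using tendsto_add[OF tendsto_const tendsto_mult[OF tendsto_const lim_1_over_n]] by simp
    show "\<exists>N. \<forall>n\<ge>N. x \<le> y + 2 * C * B * (1 / real n)"
      using that by (intro exI[of _ 1]) auto
  qed
  \<comment> \<open>Averaging cannot increase the norm, and the long averages of a midpoint are close to \<open>A\<^sub>N \<phi>\<close>.\<close>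
  have mid: "\<alpha> \<le> (\<integral>u. ((avg m \<phi> u + avg n \<phi> u) / 2)\<^sup>2 \<partial>\<mu>)" if m: "m \<ge> 1" and n: "n \<ge> 1" for m n
  proof (rule le_of_eventually_close)
    fix N :: nat assume N: "N \<ge> 1"
    have "\<bar>(avg m \<phi> u + avg n \<phi> u) / 2\<bar> \<le> C" for u
      using avg_abs_le[OF \<phi> C(2), of m u] avg_abs_le[OF \<phi> C(2), of n u]
      unfolding abs_le_iff by (simp add: field_simps)
    moreover have "\<bar>avg N \<phi> u - avg N (\<lambda>u. (avg m \<phi> u + avg n \<phi> u) / 2) u\<bar> \<le> (real (m + n) * C) / real N" for N u
    proof -
      have "avg N (\<lambda>u. (avg m \<phi> u + avg n \<phi> u) / 2) u = (avg N (avg m \<phi>) u + avg N (avg n \<phi>) u) / 2"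
        by (simp add: avg_divide avg_add bounded_measurable_intros)
      moreover have "real (m + n) * C / real N = (real m * (2 * C) / real N + real n * (2 * C) / real N) / 2"
        by (simp add: algebra_simps add_divide_distrib)
      moreover have "\<bar>z - (x + y) / 2\<bar> \<le> (p + q) / 2" if "\<bar>x - z\<bar> \<le> p" "\<bar>y - z\<bar> \<le> q" for x y z p q :: real
        using that unfolding abs_le_iff by (simp add: field_simps)
      ultimately show ?thesis
        using avg_avg_close[OF \<phi> C(2), of m N u] avg_avg_close[OF \<phi> C(2), of n N u] m n
        by simp
    qed
    ultimately have "a N \<le> (\<integral>u. ((avg m \<phi> u + avg n \<phi> u) / 2)\<^sup>2 \<partial>\<mu>) + 2 * C * ((real (m + n) * C) / real N)"
      unfolding a_def by (intro avg_asymptotically_minimal \<phi> C bounded_measurable_intros)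
    with \<alpha>_le[OF N] show "\<alpha> \<le> (\<integral>u. ((avg m \<phi> u + avg n \<phi> u) / 2)\<^sup>2 \<partial>\<mu>) + 2 * C * ((real (m + n) * C) / real N)"
      by simp
  qed
  have "\<exists>N. \<forall>n\<ge>N. a n < \<alpha> + \<epsilon> / 4"
  proof -
    obtain m where m: "m \<ge> 1" "a m < \<alpha> + \<epsilon> / 8"
      using cINF_less_iff[of "{1..}" a "\<alpha> + \<epsilon> / 8"] bdd \<epsilon> unfolding \<alpha>_def by auto
    have close: "\<bar>avg N \<phi> u - avg N (avg m \<phi>) u\<bar> \<le> (real m * (2 * C)) / real N" for N u
      using avg_avg_close[OF \<phi> C(2), of m N u] m by (simp add: abs_minus_commute)
    have upper: "a N \<le> a m + 2 * C * (real m * (2 * C) / real N)" for N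
      unfolding a_def by (intro avg_asymptotically_minimal \<phi> C bounded_measurable_intros close avg_abs_le)
    have "(\<lambda>N. a m + 2 * C * (real m * (2 * C)) * (1 / real N)) \<longlonglongrightarrow> a m"
      using tendsto_add[OF tendsto_const tendsto_mult[OF tendsto_const lim_1_over_n]] by simp
    then have "\<forall>\<^sub>F N in sequentially. a m + 2 * C * (real m * (2 * C)) * (1 / real N) < \<alpha> + \<epsilon> / 4"
      by (rule order_tendstoD) (use m \<epsilon> in auto)
    then obtain N where "\<And>n. n \<ge> N \<Longrightarrow> a m + 2 * C * (real m * (2 * C)) * (1 / real n) < \<alpha> + \<epsilon> / 4"
      unfolding eventually_sequentially by blast
    moreover have "a n \<le> a m + 2 * C * (real m * (2 * C)) * (1 / real n)" for n
      using upper[of n] by simp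
    ultimately show ?thesis
      by (meson le_less_trans)
  qed
  then obtain N where N: "\<And>n. n \<ge> N \<Longrightarrow> a n < \<alpha> + \<epsilon> / 4" by blast
  have "(\<integral>u. (avg m \<phi> u - avg n \<phi> u)\<^sup>2 \<partial>\<mu>) < \<epsilon>" if mn: "n \<ge> max N 1" "m \<ge> max N 1" for m n
  proof -
    have "(\<integral>u. (avg m \<phi> u - avg n \<phi> u)\<^sup>2 \<partial>\<mu>) =
      (\<integral>u. 2 * (avg m \<phi> u)\<^sup>2 + 2 * (avg n \<phi> u)\<^sup>2 - 4 * ((avg m \<phi> u + avg n \<phi> u) / 2)\<^sup>2 \<partial>\<mu>)"
      by (rule arg_cong[where f="integral\<^sup>L \<mu>"]) (auto simp: power2_eq_square field_simps)
    also have "\<dots> = 2 * a m + 2 * a n - 4 * (\<integral>u. ((avg m \<phi> u + avg n \<phi> u) / 2)\<^sup>2 \<partial>\<mu>)"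
      unfolding a_def by (simp add: integrable_stationary bounded_measurable_intros del: power_divide)
    also have "\<dots> < \<epsilon>"
      using mid[of m n] N[of m] N[of n] mn by auto
    finally show ?thesis .
  qed
  then show ?thesis by blast
qed

theorem mean_ergodic:
  assumes \<phi>: "bounded_measurable \<phi>"
  obtains h where "bounded_measurable h" "(\<lambda>n. \<integral>u. (avg n \<phi> u - h u)\<^sup>2 \<partial>\<mu>) \<longlonglongrightarrow> 0"
proof -
  obtain C where C: "\<And>x. \<bar>\<phi> x\<bar> \<le> C" using \<phi> by (metis bounded_measurableE)
  obtain h where "h \<in> borel_measurable \<mu>" "\<And>x. \<bar>h x\<bar> \<le> C"
    "(\<lambda>n. \<integral>u. (avg n \<phi> u - h u)\<^sup>2 \<partial>\<mu>) \<longlonglongrightarrow> 0"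
    by (rule bounded_L2_Cauchy_limit[of "\<lambda>n. avg n \<phi>" C])
      (auto intro!: measurable_stationary bounded_measurable_intros \<phi> avg_abs_le C avg_L2_Cauchy)
  moreover from this have "bounded_measurable h"
    by (intro bounded_measurableI) (auto simp: measurable_cong_sets[OF sets_\<mu> refl])
  ultimately show thesis using that by blast
qed

text \<open>\<open>K A\<^sub>n \<phi> - A\<^sub>n \<phi>\<close> is uniformly of order \<open>1/n\<close>, and \<open>K\<close> is continuous on \<open>L\<^sup>2(\<mu>)\<close>.\<close>

lemma mean_ergodic_limit_K_invariant:
  assumes \<phi>: "bounded_measurable \<phi>" and h: "bounded_measurable h"
    and lim: "(\<lambda>n. \<integral>u. (avg n \<phi> u - h u)\<^sup>2 \<partial>\<mu>) \<longlonglongrightarrow> 0"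
  shows "AE u in \<mu>. K h u = h u"
proof -
  obtain C where C: "\<And>x. \<bar>\<phi> x\<bar> \<le> C" using \<phi> by (metis bounded_measurableE)
  have "(\<integral>u. (K h u - h u)\<^sup>2 \<partial>\<mu>) \<le> 0"
  proof (rule LIMSEQ_le_const)
    have "(\<lambda>n. 6 * (\<integral>u. (avg n \<phi> u - h u)\<^sup>2 \<partial>\<mu>) + 3 * (2 * C * (1 / real n))\<^sup>2)
      \<longlonglongrightarrow> 6 * 0 + 3 * (2 * C * 0)\<^sup>2"
      by (intro tendsto_intros lim lim_1_over_n)
    then show "(\<lambda>n. 6 * (\<integral>u. (avg n \<phi> u - h u)\<^sup>2 \<partial>\<mu>) + 3 * (2 * C * (1 / real n))\<^sup>2) \<longlonglongrightarrow> 0"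
      by simp
    have "(\<integral>u. (K h u - h u)\<^sup>2 \<partial>\<mu>) \<le> 6 * (\<integral>u. (avg n \<phi> u - h u)\<^sup>2 \<partial>\<mu>) + 3 * (2 * C * (1 / real n))\<^sup>2" for n
    proof -
      let ?g = "avg n \<phi>"
      have three: "(x + y + z)\<^sup>2 \<le> 3 * x\<^sup>2 + 3 * y\<^sup>2 + 3 * z\<^sup>2" for x y z :: real
        using sum_squares_ge_zero[of "x - y" "y - z"] zero_le_power2[of "x - z"]
        by (simp add: power2_eq_square algebra_simps)
      have "(K h u - h u)\<^sup>2 \<le> 3 * (K (\<lambda>x. ?g x - h x) u)\<^sup>2 + 3 * (2 * C * (1 / real n))\<^sup>2 + 3 * (?g u - h u)\<^sup>2" for u
      proof -
        have eq: "K h u - h u = - K (\<lambda>x. ?g x - h x) u + (K ?g u - ?g u) + (?g u - h u)"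
          by (simp add: K_diff bounded_measurable_intros \<phi> h)
        have "(K h u - h u)\<^sup>2 \<le> 3 * (- K (\<lambda>x. ?g x - h x) u)\<^sup>2 + 3 * (K ?g u - ?g u)\<^sup>2 + 3 * (?g u - h u)\<^sup>2"
          by (subst eq) (rule three)
        then have "(K h u - h u)\<^sup>2 \<le> 3 * (K (\<lambda>x. ?g x - h x) u)\<^sup>2 + 3 * (K ?g u - ?g u)\<^sup>2 + 3 * (?g u - h u)\<^sup>2"
          by (simp only: power2_minus)
        moreover have "\<bar>K ?g u - ?g u\<bar> \<le> 2 * C * (1 / real n)"
          using avg_K_close[OF \<phi> C, of n u] by (simp add: K_avg \<phi>)
        then have "(K ?g u - ?g u)\<^sup>2 \<le> (2 * C * (1 / real n))\<^sup>2"
          by (metis abs_ge_zero power2_abs power_mono)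
        ultimately show ?thesis by linarith
      qed
      then have "(\<integral>u. (K h u - h u)\<^sup>2 \<partial>\<mu>) \<le>
        (\<integral>u. 3 * (K (\<lambda>x. ?g x - h x) u)\<^sup>2 + 3 * (2 * C * (1 / real n))\<^sup>2 + 3 * (?g u - h u)\<^sup>2 \<partial>\<mu>)"
        by (intro integral_mono integrable_stationary bounded_measurable_intros \<phi> h)
      also have "\<dots> = 3 * (\<integral>u. (K (\<lambda>x. ?g x - h x) u)\<^sup>2 \<partial>\<mu>) + 3 * (2 * C * (1 / real n))\<^sup>2
          + 3 * (\<integral>u. (?g u - h u)\<^sup>2 \<partial>\<mu>)"
        by (simp add: integrable_stationary bounded_measurable_intros \<phi> h prob_UNIV)
      also have "\<dots> \<le> 6 * (\<integral>u. (?g u - h u)\<^sup>2 \<partial>\<mu>) + 3 * (2 * C * (1 / real n))\<^sup>2"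
        using integral_K_square_le[of "\<lambda>x. ?g x - h x"] by (simp add: bounded_measurable_intros \<phi> h)
      finally show ?thesis .
    qed
    then show "\<exists>N. \<forall>n\<ge>N. (\<integral>u. (K h u - h u)\<^sup>2 \<partial>\<mu>)
        \<le> 6 * (\<integral>u. (avg n \<phi> u - h u)\<^sup>2 \<partial>\<mu>) + 3 * (2 * C * (1 / real n))\<^sup>2" by blast
  qed
  moreover have "(\<integral>u. (K h u - h u)\<^sup>2 \<partial>\<mu>) \<ge> 0" by simp
  ultimately have "(\<integral>u. (K h u - h u)\<^sup>2 \<partial>\<mu>) = 0" by linarith
  then have "AE u in \<mu>. (K h u - h u)\<^sup>2 = 0"
    by (subst (asm) integral_nonneg_eq_0_iff_AE) (auto intro!: integrable_stationary bounded_measurable_intros h)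
  then show ?thesis by simp
qed

text \<open>The conditional second moment of \<open>h(U\<^sub>1) - h(U\<^sub>0)\<close> given \<open>U\<^sub>0\<close> integrates to \<open>\<integral> K(h\<^sup>2) d\<mu> - \<integral> h\<^sup>2 d\<mu> = 0\<close>.\<close>

lemma K_invariant_imp_constant_along_chain:
  assumes h: "bounded_measurable h" and inv: "AE u in \<mu>. K h u = h u"
  shows "AE u in \<mu>. AE v in P u. h v = h u"
proof -
  let ?D = "\<lambda>u. \<integral>v. (h v - h u)\<^sup>2 \<partial>P u"
  have D: "?D u = K (\<lambda>x. (h x)\<^sup>2) u - 2 * h u * K h u + (h u)\<^sup>2" for u
  proof -
    interpret Pu: prob_space "P u" by (rule prob_space_kernel)
    have "?D u = (\<integral>v. (h v)\<^sup>2 - 2 * h u * h v + (h u)\<^sup>2 \<partial>P u)"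
      by (simp add: power2_eq_square algebra_simps)
    then show ?thesis
      by (simp add: kernel_op_def integrable_kernel bounded_measurable_intros h Pu.prob_space)
  qed
  have bm_D: "bounded_measurable ?D"
    unfolding D by (intro bounded_measurable_intros h)
  have "(\<integral>u. ?D u \<partial>\<mu>) = (\<integral>u. K (\<lambda>x. (h x)\<^sup>2) u - (h u)\<^sup>2 \<partial>\<mu>)"
  proof (rule integral_cong_AE)
    show "AE u in \<mu>. ?D u = K (\<lambda>x. (h x)\<^sup>2) u - (h u)\<^sup>2"
      using inv unfolding D by eventually_elim (simp add: power2_eq_square)
  qed (auto intro!: measurable_stationary bounded_measurable_intros h bm_D)
  also have "\<dots> = 0"
    by (simp add: integrable_stationary integral_K bounded_measurable_intros h)
  finally have "AE u in \<mu>. ?D u = 0"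
    by (subst (asm) integral_nonneg_eq_0_iff_AE) (auto intro!: integrable_stationary bm_D)
  then show ?thesis
  proof eventually_elim
    case (elim u)
    then have "AE v in P u. (h v - h u)\<^sup>2 = 0"
      by (subst (asm) integral_nonneg_eq_0_iff_AE) (auto intro!: integrable_kernel bounded_measurable_intros h)
    then show ?case by simp
  qed
qed

text \<open>A function that is constant along the chain can be moved inside \<open>K\<close>, so \<open>\<langle>K f, h\<rangle> = \<integral> K (f h) d\<mu> = \<langle>f, h\<rangle>\<close>.
This expresses \<open>K\<^sup>* h = h\<close> for the adjoint of \<open>K\<close> in \<open>L\<^sup>2(\<mu>)\<close>.\<close>

lemma integral_avg_mult_invariant:
  assumes f: "bounded_measurable f" and h: "bounded_measurable h"
    and const: "AE u in \<mu>. AE v in P u. h v = h u" and n: "n > 0"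
  shows "(\<integral>u. avg n f u * h u \<partial>\<mu>) = (\<integral>u. f u * h u \<partial>\<mu>)"
proof -
  have step: "(\<integral>u. K f u * h u \<partial>\<mu>) = (\<integral>u. f u * h u \<partial>\<mu>)" if f: "bounded_measurable f" for f
  proof -
    have "(\<integral>u. f u * h u \<partial>\<mu>) = (\<integral>u. K (\<lambda>x. f x * h x) u \<partial>\<mu>)"
      by (simp add: integral_K bounded_measurable_intros f h)
    also have "\<dots> = (\<integral>u. K f u * h u \<partial>\<mu>)"
    proof (rule integral_cong_AE)
      show "AE u in \<mu>. K (\<lambda>x. f x * h x) u = K f u * h u"
        using const
      proof eventually_elim
        case (elim u)
        have "(\<integral>v. f v * h v \<partial>P u) = (\<integral>v. f v * h u \<partial>P u)"
          using elim by (intro integral_cong_AE)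
            (auto intro!: borel_measurable_integrable[OF integrable_kernel] bounded_measurable_intros f h)
        then show ?case by (simp add: kernel_op_def)
      qed
    qed (auto intro!: measurable_stationary bounded_measurable_intros f h)
    finally show ?thesis by simp
  qed
  have Kn: "(\<integral>u. Kn k f u * h u \<partial>\<mu>) = (\<integral>u. f u * h u \<partial>\<mu>)" for k
    by (induction k) (simp_all add: step bounded_measurable_intros f)
  have "(\<integral>u. avg n f u * h u \<partial>\<mu>) = (\<integral>u. (\<Sum>k=1..n. Kn k f u * h u) / real n \<partial>\<mu>)"
    by (simp add: avg_def sum_distrib_right)
  also have "\<dots> = (\<Sum>k=1..n. \<integral>u. Kn k f u * h u \<partial>\<mu>) / real n"
    by (simp add: Bochner_Integration.integral_sum integrable_stationary bounded_measurable_intros f h)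
  also have "\<dots> = (\<integral>u. f u * h u \<partial>\<mu>)"
    using n by (simp add: Kn)
  finally show ?thesis .
qed

lemma L2_limit_imp_weak_limit:
  assumes g: "\<And>n. bounded_measurable (g n)" and h: "bounded_measurable h"
    and lim: "(\<lambda>n. \<integral>u. (g n u - h u)\<^sup>2 \<partial>\<mu>) \<longlonglongrightarrow> 0"
    and f: "bounded_measurable f"
  shows "(\<lambda>n. \<integral>u. g n u * f u \<partial>\<mu>) \<longlonglongrightarrow> (\<integral>u. h u * f u \<partial>\<mu>)"
proof -
  obtain C where C: "C \<ge> 0" "\<And>x. \<bar>f x\<bar> \<le> C" using f by (metis bounded_measurableE)
  have "(\<lambda>n. (\<integral>u. (g n u - h u) * f u \<partial>\<mu>)\<^sup>2) \<longlonglongrightarrow> 0"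
  proof (rule tendsto_sandwich[of "\<lambda>_. 0"])
    have "(\<integral>u. (g n u - h u) * f u \<partial>\<mu>)\<^sup>2 \<le> C\<^sup>2 * (\<integral>u. (g n u - h u)\<^sup>2 \<partial>\<mu>)" for n
    proof -
      have "(\<integral>u. (g n u - h u) * f u \<partial>\<mu>)\<^sup>2 \<le> (\<integral>u. ((g n u - h u) * f u)\<^sup>2 \<partial>\<mu>)"
        by (intro square_integral_le integrable_stationary bounded_measurable_intros g h f)
      also have "\<dots> \<le> (\<integral>u. C\<^sup>2 * (g n u - h u)\<^sup>2 \<partial>\<mu>)"
      proof (intro integral_mono integrable_stationary bounded_measurable_intros g h f)
        fix u
        have "(f u)\<^sup>2 \<le> C\<^sup>2" using C by (metis abs_ge_zero power2_abs power_mono)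
        then show "((g n u - h u) * f u)\<^sup>2 \<le> C\<^sup>2 * (g n u - h u)\<^sup>2"
          by (simp add: power_mult_distrib mult.commute mult_right_mono)
      qed
      finally show ?thesis by simp
    qed
    then show "\<forall>\<^sub>F n in sequentially. (\<integral>u. (g n u - h u) * f u \<partial>\<mu>)\<^sup>2 \<le> C\<^sup>2 * (\<integral>u. (g n u - h u)\<^sup>2 \<partial>\<mu>)"
      by simp
    show "(\<lambda>n. C\<^sup>2 * (\<integral>u. (g n u - h u)\<^sup>2 \<partial>\<mu>)) \<longlonglongrightarrow> 0"
      using tendsto_mult[OF tendsto_const lim] by simp
  qed auto
  then have "(\<lambda>n. \<integral>u. (g n u - h u) * f u \<partial>\<mu>) \<longlonglongrightarrow> 0"
    by (auto dest!: tendsto_real_sqrt simp: tendsto_rabs_zero_iff)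
  moreover have "(\<integral>u. (g n u - h u) * f u \<partial>\<mu>) = (\<integral>u. g n u * f u \<partial>\<mu>) - (\<integral>u. h u * f u \<partial>\<mu>)" for n
    by (simp add: left_diff_distrib integrable_stationary bounded_measurable_intros g h f)
  ultimately show ?thesis by (simp add: LIM_zero_iff)
qed

text \<open>By stationarity the double sum is \<open>n\<^sup>2\<close> times the second moment of the time average. Passing from \<open>n\<close> to
\<open>n + 1\<close> adds \<open>2 (c 1 + \<dots> + c n) + c 0\<close>, and \<open>c 1 + \<dots> + c n = n \<langle>A\<^sub>n \<phi>, \<phi>\<rangle>\<close>.\<close>

lemma mean_square_correlation:
  assumes \<phi>: "bounded_measurable \<phi>" and h: "bounded_measurable h"
    and lim: "(\<lambda>n. \<integral>u. (avg n \<phi> u - h u)\<^sup>2 \<partial>\<mu>) \<longlonglongrightarrow> 0"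
  defines "c \<equiv> \<lambda>d. \<integral>u. \<phi> u * Kn d \<phi> u \<partial>\<mu>"
  shows "(\<lambda>n. (\<Sum>j=1..n. \<Sum>k=1..n. c (max j k - min j k)) / (real n)\<^sup>2) \<longlonglongrightarrow> (\<integral>u. h u * \<phi> u \<partial>\<mu>)"
proof (rule quadratic_growth)
  let ?W = "\<lambda>n. \<Sum>j=1..n. \<Sum>k=1..n. c (max j k - min j k)"
  show "(\<lambda>n. \<integral>u. avg n \<phi> u * \<phi> u \<partial>\<mu>) \<longlonglongrightarrow> (\<integral>u. h u * \<phi> u \<partial>\<mu>)"
    by (intro L2_limit_imp_weak_limit bounded_measurable_intros \<phi> h lim)
  fix n
  have "(\<Sum>k=1..n. c (Suc n - k)) = (\<Sum>d=1..n. c d)"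
    by (subst sum.atLeastAtMost_rev) simp
  also have "\<dots> = (\<integral>u. (\<Sum>d=1..n. \<phi> u * Kn d \<phi> u) \<partial>\<mu>)"
    by (simp add: c_def Bochner_Integration.integral_sum integrable_stationary bounded_measurable_intros \<phi>)
  also have "\<dots> = (\<integral>u. real n * (avg n \<phi> u * \<phi> u) \<partial>\<mu>)"
    by (cases "n = 0") (simp_all add: avg_def sum_distrib_left[symmetric] mult.commute)
  also have "\<dots> = real n * (\<integral>u. avg n \<phi> u * \<phi> u \<partial>\<mu>)" by simp
  finally have s: "(\<Sum>k=1..n. c (Suc n - k)) = real n * (\<integral>u. avg n \<phi> u * \<phi> u \<partial>\<mu>)" .
  have "?W (Suc n) = ?W n + (\<Sum>j=1..n. c (Suc n - j)) + (\<Sum>k=1..n. c (Suc n - k)) + c 0"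
    by (simp add: sum.distrib max_def min_def)
  then show "?W (Suc n) = ?W n + 2 * (real n * (\<integral>u. avg n \<phi> u * \<phi> u \<partial>\<mu>)) + c 0"
    by (simp only: s)
qed simp

end

section \<open>One- and two-time marginals of the chain\<close>

context markov_chain begin

abbreviation law :: "'a \<Rightarrow> (nat \<Rightarrow> 'a) measure" where
  "law u \<equiv> chain_law (return borel u) P"

lemma return_prob_algebra: "return borel u \<in> space (prob_algebra borel)"
  by (simp add: space_prob_algebra prob_space_return)

context
  fixes u :: 'a
begin

interpretation IT: Ionescu_Tulcea "chain_step (return borel u) P" "\<lambda>_. borel"
  by (rule Ionescu_Tulcea_chain_step[OF return_prob_algebra kernel])

lemma full_chain_law_eq: "full_chain_law (return borel u) P = IT.PF.lim"
  by (simp add: full_chain_law_def)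

lemma sets_full_chain_law: "sets (full_chain_law (return borel u) P) = sets (Pi\<^sub>M UNIV (\<lambda>_. borel))"
  by (simp add: full_chain_law_eq)

lemma up_to_Ico: "IT.up_to {0..<n} = n"
proof (rule antisym)
  show "IT.up_to {0..<n} \<le> n" by (subst IT.up_to_iff_Ico) auto
  show "n \<le> IT.up_to {0..<n}" using IT.up_to[of "{0..<n}"] by (cases "n = 0") simp_all
qed

text \<open>Transfers integrals of functions of finitely many coordinates from the projective limit to the
iterated kernels \<open>C\<close> of the Ionescu-Tulcea construction, where they can be computed step by step.\<close>

lemma integral_full_chain_law:
  fixes F :: "(nat \<Rightarrow> 'a) \<Rightarrow> real"
  assumes F: "F \<in> borel_measurable (Pi\<^sub>M {0..<n} (\<lambda>_. borel))"
  shows "(\<integral>\<omega>. F (restrict \<omega> {0..<n}) \<partial>full_chain_law (return borel u) P) = (\<integral>\<omega>. F \<omega> \<partial>IT.C 0 n (\<lambda>_. undefined))"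
proof -
  have sets_C: "sets (IT.C 0 n (\<lambda>_. undefined)) = sets (Pi\<^sub>M {0..<n} (\<lambda>_. borel))"
    using IT.sets_C[of "\<lambda>_. undefined" 0 n] by (simp add: space_PiM)
  have [measurable]: "(\<lambda>\<omega>. restrict \<omega> {0..<n}) \<in> full_chain_law (return borel u) P \<rightarrow>\<^sub>M Pi\<^sub>M {0..<n} (\<lambda>_. borel)"
    unfolding measurable_cong_sets[OF sets_full_chain_law refl] by (rule measurable_restrict_subset) simp
  have [measurable]: "(\<lambda>\<omega>. restrict \<omega> {0..<n}) \<in> IT.C 0 n (\<lambda>_. undefined) \<rightarrow>\<^sub>M Pi\<^sub>M {0..<n} (\<lambda>_. borel)"
    unfolding measurable_cong_sets[OF sets_C refl] by (rule measurable_restrict_subset) simp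
  have "(\<integral>\<omega>. F (restrict \<omega> {0..<n}) \<partial>full_chain_law (return borel u) P)
      = (\<integral>\<omega>. F \<omega> \<partial>distr (full_chain_law (return borel u) P) (Pi\<^sub>M {0..<n} (\<lambda>_. borel)) (\<lambda>\<omega>. restrict \<omega> {0..<n}))"
    by (rule integral_distr[symmetric]) (measurable, rule F)
  also have "distr (full_chain_law (return borel u) P) (Pi\<^sub>M {0..<n} (\<lambda>_. borel)) (\<lambda>\<omega>. restrict \<omega> {0..<n})
      = distr (IT.C 0 n (\<lambda>_. undefined)) (Pi\<^sub>M {0..<n} (\<lambda>_. borel)) (\<lambda>\<omega>. restrict \<omega> {0..<n})"
    using IT.distr_lim[of "{0..<n}"] unfolding full_chain_law_eq IT.CI_def up_to_Ico by simp
  also have "(\<integral>\<omega>. F \<omega> \<partial>\<dots>) = (\<integral>\<omega>. F (restrict \<omega> {0..<n}) \<partial>IT.C 0 n (\<lambda>_. undefined))"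
    by (rule integral_distr) (measurable, rule F)
  also have "\<dots> = (\<integral>\<omega>. F \<omega> \<partial>IT.C 0 n (\<lambda>_. undefined))"
  proof (rule Bochner_Integration.integral_cong[OF refl])
    fix \<omega> assume "\<omega> \<in> space (IT.C 0 n (\<lambda>_. undefined))"
    then have "\<omega> \<in> extensional {0..<n}"
      by (simp add: sets_eq_imp_space_eq[OF sets_C] space_PiM PiE_iff)
    then show "F (restrict \<omega> {0..<n}) = F \<omega>" by (simp add: extensional_restrict)
  qed
  finally show ?thesis .
qed

lemma integral_C_Suc:
  fixes F :: "(nat \<Rightarrow> 'a) \<Rightarrow> real"
  assumes F: "F \<in> borel_measurable (Pi\<^sub>M {0..<Suc n} (\<lambda>_. borel))" and B: "\<And>\<omega>. \<bar>F \<omega>\<bar> \<le> B"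
  shows "(\<integral>\<omega>. F \<omega> \<partial>IT.C 0 (Suc n) (\<lambda>_. undefined))
    = (\<integral>\<omega>. \<integral>v. F (fun_upd \<omega> n v) \<partial>chain_step (return borel u) P n \<omega> \<partial>IT.C 0 n (\<lambda>_. undefined))"
proof -
  have und: "(\<lambda>_. undefined) \<in> space (Pi\<^sub>M {0..<0::nat} (\<lambda>_. borel :: 'a measure))"
    by (simp add: space_PiM)
  have sets_C: "sets (IT.C 0 n (\<lambda>_. undefined)) = sets (Pi\<^sub>M {0..<n} (\<lambda>_. borel))"
    using IT.sets_C[OF und, of n] by simp
  interpret C: prob_space "IT.C 0 n (\<lambda>_. undefined)"
    by (rule IT.prob_space_C[OF und])
  have eP: "IT.eP n \<in> IT.C 0 n (\<lambda>_. undefined) \<rightarrow>\<^sub>M subprob_algebra (Pi\<^sub>M {0..<Suc n} (\<lambda>_. borel))"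
    unfolding measurable_cong_sets[OF sets_C refl] by (rule IT.measurable_eP)
  have "(\<integral>\<omega>. F \<omega> \<partial>IT.C 0 (Suc n) (\<lambda>_. undefined)) = (\<integral>\<omega>. F \<omega> \<partial>(IT.C 0 n (\<lambda>_. undefined) \<bind> IT.eP n))"
    by simp
  also have "\<dots> = (\<integral>\<omega>. integral\<^sup>L (IT.eP n \<omega>) F \<partial>IT.C 0 n (\<lambda>_. undefined))"
  proof (rule integral_bind[OF F B eP C.finite_measure_axioms, of 1])
    show "AE \<omega> in IT.C 0 n (\<lambda>_. undefined). emeasure (IT.eP n \<omega>) (space (IT.eP n \<omega>)) \<le> ennreal 1"
      by (rule AE_I2) (simp add: sets_eq_imp_space_eq[OF sets_C] prob_space.emeasure_space_1[OF IT.prob_space_eP])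
  qed
  also have "\<dots> = (\<integral>\<omega>. \<integral>v. F (fun_upd \<omega> n v) \<partial>chain_step (return borel u) P n \<omega> \<partial>IT.C 0 n (\<lambda>_. undefined))"
  proof (rule Bochner_Integration.integral_cong[OF refl])
    fix \<omega> assume "\<omega> \<in> space (IT.C 0 n (\<lambda>_. undefined))"
    then have \<omega>: "\<omega> \<in> space (Pi\<^sub>M {0..<n} (\<lambda>_. borel))"
      by (simp add: sets_eq_imp_space_eq[OF sets_C])
    show "integral\<^sup>L (IT.eP n \<omega>) F = (\<integral>v. F (fun_upd \<omega> n v) \<partial>chain_step (return borel u) P n \<omega>)"
      unfolding IT.eP_def
    proof (rule integral_distr[OF _ F])
      show "fun_upd \<omega> n \<in> chain_step (return borel u) P n \<omega> \<rightarrow>\<^sub>M Pi\<^sub>M {0..<Suc n} (\<lambda>_. borel)"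
        unfolding measurable_cong_sets[OF IT.sets_P[OF \<omega>] refl]
        by (rule measurable_fun_upd[where J="{0..<n}"]) (auto intro: measurable_const \<omega>)
    qed
  qed
  finally show ?thesis .
qed

lemma integral_full_chain_law_0:
  assumes f: "bounded_measurable f"
  shows "(\<integral>\<omega>. f (\<omega> 0) \<partial>full_chain_law (return borel u) P) = f u"
proof -
  obtain C where C: "\<And>x. \<bar>f x\<bar> \<le> C" using f by (metis bounded_measurableE)
  note [measurable] = bounded_measurableD[OF f]
  have m: "(\<lambda>\<omega>. f (\<omega> 0)) \<in> borel_measurable (Pi\<^sub>M {0..<Suc 0} (\<lambda>_. borel))"
    by measurable
  have "(\<integral>\<omega>. f (\<omega> 0) \<partial>full_chain_law (return borel u) P) = (\<integral>\<omega>. f (\<omega> 0) \<partial>IT.C 0 (Suc 0) (\<lambda>_. undefined))"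
    using integral_full_chain_law[OF m] by simp
  also have "\<dots> = (\<integral>\<omega>. f u \<partial>IT.C 0 0 (\<lambda>_. undefined))"
    by (subst integral_C_Suc[OF m C]) (simp add: chain_step_def integral_return)
  also have "\<dots> = f u"
    using IT.prob_space_C[of "\<lambda>_. undefined" 0 0, THEN prob_space.prob_space]
    by (simp add: space_PiM del: IT.C.simps)
  finally show ?thesis .
qed

text \<open>The Markov property at time \<open>n\<close>, for test functions of one past coordinate; iterated, it gives all
two-time marginals, and these are all that second moments of time averages involve.\<close>

lemma integral_full_chain_law_Suc:
  assumes f: "bounded_measurable f" and g: "bounded_measurable g" and i: "i \<le> n"
  shows "(\<integral>\<omega>. g (\<omega> i) * f (\<omega> (Suc n)) \<partial>full_chain_law (return borel u) P)
    = (\<integral>\<omega>. g (\<omega> i) * K f (\<omega> n) \<partial>full_chain_law (return borel u) P)"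
proof -
  obtain C where C: "C \<ge> 0" "\<And>x. \<bar>f x\<bar> \<le> C" using f by (metis bounded_measurableE)
  obtain D where D: "D \<ge> 0" "\<And>x. \<bar>g x\<bar> \<le> D" using g by (metis bounded_measurableE)
  have coord: "(\<lambda>\<omega>. e (\<omega> k)) \<in> borel_measurable (Pi\<^sub>M {0..<N} (\<lambda>_. borel))"
    if "bounded_measurable e" "k < N" for e :: "'a \<Rightarrow> real" and k N :: nat
  proof -
    have "(\<lambda>\<omega>. \<omega> k) \<in> Pi\<^sub>M {0..<N} (\<lambda>_. borel) \<rightarrow>\<^sub>M (borel :: 'a measure)"
      by (rule measurable_component_singleton) (use that in auto)
    from measurable_compose[OF this bounded_measurableD[OF that(1)]] show ?thesis .
  qed
  have m: "(\<lambda>\<omega>. g (\<omega> i) * f (\<omega> (Suc n))) \<in> borel_measurable (Pi\<^sub>M {0..<Suc (Suc n)} (\<lambda>_. borel))"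
    using i by (intro borel_measurable_times coord f g) auto
  have m': "(\<lambda>\<omega>. g (\<omega> i) * K f (\<omega> n)) \<in> borel_measurable (Pi\<^sub>M {0..<Suc n} (\<lambda>_. borel))"
    using i by (intro borel_measurable_times coord bounded_measurable_intros f g) auto
  have B: "\<bar>g (\<omega> i) * f (\<omega> (Suc n))\<bar> \<le> D * C" for \<omega>
    using C D by (simp add: abs_mult mult_mono)
  have "(\<integral>\<omega>. g (\<omega> i) * f (\<omega> (Suc n)) \<partial>full_chain_law (return borel u) P)
    = (\<integral>\<omega>. g (\<omega> i) * f (\<omega> (Suc n)) \<partial>IT.C 0 (Suc (Suc n)) (\<lambda>_. undefined))"
    using integral_full_chain_law[OF m] i by simp
  also have "\<dots> = (\<integral>\<omega>. g (\<omega> i) * K f (\<omega> n) \<partial>IT.C 0 (Suc n) (\<lambda>_. undefined))"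
    using i by (subst integral_C_Suc[OF m B]) (simp add: chain_step_def kernel_op_def)
  also have "\<dots> = (\<integral>\<omega>. g (\<omega> i) * K f (\<omega> n) \<partial>full_chain_law (return borel u) P)"
    using integral_full_chain_law[OF m'] i by simp
  finally show ?thesis .
qed

lemma sets_law[simp, measurable_cong]: "sets (law u) = sets seq_space"
  by (simp add: chain_law_def)

lemma measurable_tail: "(\<lambda>\<omega>. restrict \<omega> {1..}) \<in> full_chain_law (return borel u) P \<rightarrow>\<^sub>M seq_space"
  unfolding measurable_cong_sets[OF sets_full_chain_law refl] seq_space_def
  by (rule measurable_restrict_subset) simp

lemma prob_space_law: "prob_space (law u)"
proof -
  have "prob_space (full_chain_law (return borel u) P)"
  proof (rule prob_space_distrD)
    show "(\<lambda>\<omega>. restrict \<omega> {0..<0}) \<in> full_chain_law (return borel u) P \<rightarrow>\<^sub>M Pi\<^sub>M {0..<0} (\<lambda>_. borel)"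
      unfolding measurable_cong_sets[OF sets_full_chain_law refl] by (rule measurable_restrict_subset) simp
    show "prob_space (distr (full_chain_law (return borel u) P) (Pi\<^sub>M {0..<0} (\<lambda>_. borel)) (\<lambda>\<omega>. restrict \<omega> {0..<0}))"
      unfolding full_chain_law_eq by (subst IT.distr_lim) (auto intro: IT.PF.prob_space_P)
  qed
  then show ?thesis
    unfolding chain_law_def by (rule prob_space.prob_space_distr[OF _ measurable_tail])
qed

end

lemma measurable_seq_component[measurable]:
  "k \<ge> 1 \<Longrightarrow> (\<lambda>\<omega>. \<omega> k) \<in> seq_space \<rightarrow>\<^sub>M borel"
  unfolding seq_space_def by (rule measurable_component_singleton) simp

lemma integral_full_two_times:
  assumes f: "bounded_measurable f" and g: "bounded_measurable g"
  shows "(\<integral>\<omega>. g (\<omega> i) * f (\<omega> (i + d)) \<partial>full_chain_law (return borel u) P)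
    = (\<integral>\<omega>. g (\<omega> i) * Kn d f (\<omega> i) \<partial>full_chain_law (return borel u) P)"
  using f
proof (induction d arbitrary: f)
  case (Suc d)
  have "(\<integral>\<omega>. g (\<omega> i) * f (\<omega> (i + Suc d)) \<partial>full_chain_law (return borel u) P)
    = (\<integral>\<omega>. g (\<omega> i) * K f (\<omega> (i + d)) \<partial>full_chain_law (return borel u) P)"
    using integral_full_chain_law_Suc[OF Suc.prems g, of i "i + d"] by simp
  also have "\<dots> = (\<integral>\<omega>. g (\<omega> i) * Kn d (K f) (\<omega> i) \<partial>full_chain_law (return borel u) P)"
    by (rule Suc.IH[OF bounded_measurable_K[OF Suc.prems]])
  finally show ?case by (simp only: funpow_Suc_right o_apply)
qed simp

lemma integral_full_one_time:
  assumes f: "bounded_measurable f"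
  shows "(\<integral>\<omega>. f (\<omega> n) \<partial>full_chain_law (return borel u) P) = Kn n f u"
  using integral_full_two_times[OF f bounded_measurable_const[of 1], where i=0 and d=n and u=u]
    integral_full_chain_law_0[OF bounded_measurable_Kn[OF f, of n], of u] by simp

lemma integral_law_one_time:
  assumes f: "bounded_measurable f" and n: "n \<ge> 1"
  shows "(\<integral>\<omega>. f (\<omega> n) \<partial>law u) = Kn n f u"
proof -
  note [measurable] = bounded_measurableD[OF f] measurable_seq_component[OF n]
  have "(\<integral>\<omega>. f (\<omega> n) \<partial>law u) = (\<integral>\<omega>. f (restrict \<omega> {1..} n) \<partial>full_chain_law (return borel u) P)"
    unfolding chain_law_def by (rule integral_distr[OF measurable_tail]) measurable
  then show ?thesis using n integral_full_one_time[OF f, where n=n and u=u] by simp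
qed

lemma integral_law_two_times:
  assumes f: "bounded_measurable f" and g: "bounded_measurable g" and i: "i \<ge> 1"
  shows "(\<integral>\<omega>. g (\<omega> i) * f (\<omega> (i + d)) \<partial>law u) = Kn i (\<lambda>x. g x * Kn d f x) u"
proof -
  have id: "i + d \<ge> 1" using i by simp
  note [measurable] = bounded_measurableD[OF f] bounded_measurableD[OF g]
    measurable_seq_component[OF i] measurable_seq_component[OF id]
  have "(\<integral>\<omega>. g (\<omega> i) * f (\<omega> (i + d)) \<partial>law u)
    = (\<integral>\<omega>. g (restrict \<omega> {1..} i) * f (restrict \<omega> {1..} (i + d)) \<partial>full_chain_law (return borel u) P)"
    unfolding chain_law_def by (rule integral_distr[OF measurable_tail]) measurable
  also have "\<dots> = (\<integral>\<omega>. g (\<omega> i) * f (\<omega> (i + d)) \<partial>full_chain_law (return borel u) P)"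
    using i by simp
  also have "\<dots> = Kn i (\<lambda>x. g x * Kn d f x) u"
    using integral_full_two_times[OF f g, where i=i and d=d and u=u]
      integral_full_one_time[where f="\<lambda>x. g x * Kn d f x" and n=i and u=u] by (simp add: bounded_measurable_intros f g)
  finally show ?thesis .
qed

lemma integral_law_product:
  assumes f: "bounded_measurable f" and j: "j \<ge> 1" and k: "k \<ge> 1"
  shows "(\<integral>\<omega>. f (\<omega> j) * f (\<omega> k) \<partial>law u) = Kn (min j k) (\<lambda>x. f x * Kn (max j k - min j k) f x) u"
proof (cases "j \<le> k")
  case True
  then show ?thesis using integral_law_two_times[OF f f j, where d="k - j" and u=u] by simp
next
  case False
  then show ?thesis using integral_law_two_times[OF f f k, where d="j - k" and u=u]
    by (simp add: mult.commute min_def max_def)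
qed

end

section \<open>Time averages along the chain\<close>

definition time_avg :: "('a \<Rightarrow> real) \<Rightarrow> nat \<Rightarrow> (nat \<Rightarrow> 'a) \<Rightarrow> real" where
  "time_avg \<phi> n \<omega> = (\<Sum>k=1..n. \<phi> (\<omega> k)) / real n"

lemma (in markov_chain) integrable_law_coordinates:
  assumes f: "bounded_measurable f" and g: "bounded_measurable g" and j: "j \<ge> 1" and k: "k \<ge> 1"
  shows "integrable (law u) (\<lambda>\<omega>. f (\<omega> j) * g (\<omega> k))" "integrable (law u) (\<lambda>\<omega>. f (\<omega> j))"
proof -
  interpret prob_space "law u" by (rule prob_space_law)
  obtain C where C: "C \<ge> 0" "\<And>x. \<bar>f x\<bar> \<le> C" using f by (metis bounded_measurableE)
  obtain D where D: "D \<ge> 0" "\<And>x. \<bar>g x\<bar> \<le> D" using g by (metis bounded_measurableE)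
  have m: "(\<lambda>\<omega>. f (\<omega> j)) \<in> borel_measurable (law u)" "(\<lambda>\<omega>. g (\<omega> k)) \<in> borel_measurable (law u)"
    using measurable_compose[OF measurable_seq_component[OF j] bounded_measurableD[OF f]]
      measurable_compose[OF measurable_seq_component[OF k] bounded_measurableD[OF g]]
    by (simp_all add: measurable_cong_sets[OF sets_law refl])
  show "integrable (law u) (\<lambda>\<omega>. f (\<omega> j) * g (\<omega> k))"
    using C D by (intro integrable_const_bound[of _ "C * D"] borel_measurable_times m)
      (auto simp: abs_mult intro!: mult_mono)
  show "integrable (law u) (\<lambda>\<omega>. f (\<omega> j))"
    using C by (intro integrable_const_bound[of _ C] m) auto
qed

context markov_chain begin

text \<open>The second moment of the sum of \<open>\<phi>\<close> over the times \<open>1, \<dots>, n\<close>, for the chain started at \<open>u\<close>. Its expression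
through \<open>K\<close> makes it measurable in \<open>u\<close>, and computable under an invariant measure.\<close>

definition second_moment :: "('a \<Rightarrow> real) \<Rightarrow> nat \<Rightarrow> 'a \<Rightarrow> real" where
  "second_moment \<phi> n u =
    (\<Sum>j=1..n. \<Sum>k=1..n. Kn (min j k) (\<lambda>x. \<phi> x * Kn (max j k - min j k) \<phi> x) u)"

lemma bounded_measurable_second_moment[bounded_measurable_intros]: "bounded_measurable \<phi> \<Longrightarrow> bounded_measurable (second_moment \<phi> n)"
  unfolding second_moment_def[abs_def] by (intro bounded_measurable_intros)

lemma
  assumes \<phi>: "bounded_measurable \<phi>"
  shows integral_time_avg_error: "(\<integral>\<omega>. (time_avg \<phi> n \<omega> - c)\<^sup>2 \<partial>law u)
      = second_moment \<phi> n u / (real n)\<^sup>2 - 2 * c * avg n \<phi> u + c\<^sup>2" (is ?eq)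
    and integrable_time_avg_error: "integrable (law u) (\<lambda>\<omega>. (time_avg \<phi> n \<omega> - c)\<^sup>2)" (is ?int)
proof -
  interpret prob_space "law u" by (rule prob_space_law)
  have expand: "(time_avg \<phi> n \<omega> - c)\<^sup>2 = (\<Sum>j=1..n. \<Sum>k=1..n. \<phi> (\<omega> j) * \<phi> (\<omega> k)) / (real n)\<^sup>2
      - 2 * c * ((\<Sum>k=1..n. \<phi> (\<omega> k)) / real n) + c\<^sup>2" for \<omega>
    unfolding time_avg_def sum_product[symmetric] by (simp add: power2_eq_square algebra_simps)
  have int2: "integrable (law u) (\<lambda>\<omega>. \<phi> (\<omega> j) * \<phi> (\<omega> k))" if "j \<in> {1..n}" "k \<in> {1..n}" for j k
    using that by (intro integrable_law_coordinates \<phi>) auto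
  have int1: "integrable (law u) (\<lambda>\<omega>. \<phi> (\<omega> k))" if "k \<in> {1..n}" for k
    using that by (intro integrable_law_coordinates[OF \<phi> \<phi>, of k k]) auto
  have ints: "integrable (law u) (\<lambda>\<omega>. \<Sum>j=1..n. \<Sum>k=1..n. \<phi> (\<omega> j) * \<phi> (\<omega> k))"
    "integrable (law u) (\<lambda>\<omega>. \<Sum>k=1..n. \<phi> (\<omega> k))"
    by (intro Bochner_Integration.integrable_sum int2 int1; assumption)+
  show ?int
    unfolding expand
    by (intro Bochner_Integration.integrable_add Bochner_Integration.integrable_diff
      integrable_divide integrable_mult_right integrable_const ints)
  have "(\<integral>\<omega>. (time_avg \<phi> n \<omega> - c)\<^sup>2 \<partial>law u)
    = (\<integral>\<omega>. (\<Sum>j=1..n. \<Sum>k=1..n. \<phi> (\<omega> j) * \<phi> (\<omega> k)) \<partial>law u) / (real n)\<^sup>2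
      - 2 * c * ((\<integral>\<omega>. (\<Sum>k=1..n. \<phi> (\<omega> k)) \<partial>law u) / real n) + c\<^sup>2"
    unfolding expand using ints prob_space by simp
  also have "(\<integral>\<omega>. (\<Sum>j=1..n. \<Sum>k=1..n. \<phi> (\<omega> j) * \<phi> (\<omega> k)) \<partial>law u)
      = (\<Sum>j=1..n. \<Sum>k=1..n. \<integral>\<omega>. \<phi> (\<omega> j) * \<phi> (\<omega> k) \<partial>law u)"
    by (subst Bochner_Integration.integral_sum, intro Bochner_Integration.integrable_sum int2; assumption?)
      (intro sum.cong refl Bochner_Integration.integral_sum int2; assumption)
  also have "\<dots> = second_moment \<phi> n u"
    unfolding second_moment_def by (intro sum.cong refl integral_law_product \<phi>) auto
  also have "(\<integral>\<omega>. (\<Sum>k=1..n. \<phi> (\<omega> k)) \<partial>law u) = (\<Sum>k=1..n. \<integral>\<omega>. \<phi> (\<omega> k) \<partial>law u)"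
    by (intro Bochner_Integration.integral_sum int1)
  also have "\<dots> = (\<Sum>k=1..n. Kn k \<phi> u)"
    by (intro sum.cong refl integral_law_one_time \<phi>) auto
  finally show ?eq by (simp add: avg_def)
qed

end

context stationary_chain begin

text \<open>Expanding the square and integrating over \<open>\<mu>\<close>, the error is
\<open>E S\<^sub>n\<^sup>2 - 2 \<langle>A\<^sub>n \<phi>, h\<rangle> + \<parallel>h\<parallel>\<^sup>2\<close>, which tends to \<open>\<langle>h, \<phi>\<rangle> - 2 \<parallel>h\<parallel>\<^sup>2 + \<parallel>h\<parallel>\<^sup>2\<close>, and \<open>\<langle>h, \<phi>\<rangle> = \<parallel>h\<parallel>\<^sup>2\<close> since
\<open>\<langle>A\<^sub>n \<phi>, h\<rangle>\<close> does not depend on \<open>n \<ge> 1\<close>.\<close>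

theorem time_avg_mean_square_limit:
  assumes \<phi>: "bounded_measurable \<phi>"
  obtains h where "bounded_measurable h" "AE u in \<mu>. AE v in P u. h v = h u"
    "(\<integral>u. h u \<partial>\<mu>) = (\<integral>u. \<phi> u \<partial>\<mu>)"
    "(\<lambda>n. \<integral>u. (\<integral>\<omega>. (time_avg \<phi> n \<omega> - h u)\<^sup>2 \<partial>law u) \<partial>\<mu>) \<longlonglongrightarrow> 0"
proof -
  obtain h where h: "bounded_measurable h" and lim: "(\<lambda>n. \<integral>u. (avg n \<phi> u - h u)\<^sup>2 \<partial>\<mu>) \<longlonglongrightarrow> 0"
    using mean_ergodic[OF \<phi>] by blast
  have const: "AE u in \<mu>. AE v in P u. h v = h u"
    by (intro K_invariant_imp_constant_along_chain mean_ergodic_limit_K_invariant[OF \<phi>] h lim)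
  have weak: "(\<lambda>n. \<integral>u. avg n \<phi> u * f u \<partial>\<mu>) \<longlonglongrightarrow> (\<integral>u. h u * f u \<partial>\<mu>)" if "bounded_measurable f" for f
    by (intro L2_limit_imp_weak_limit bounded_measurable_intros \<phi> h lim that)
  \<comment> \<open>Quantities \<open>X n\<close> that do not depend on \<open>n > 0\<close> equal their limit; \<open>n = 0\<close> is excluded by the default value of \<open>avg\<close>.\<close>
  have constant_seq: "x = y" if "X \<longlonglongrightarrow> x" "\<And>n. n > 0 \<Longrightarrow> X n = y" for X and x y :: real
  proof (rule LIMSEQ_unique[OF that(1)])
    have "\<forall>\<^sub>F n in sequentially. X n = y"
      using eventually_gt_at_top[of 0] by eventually_elim (rule that(2))
    then show "X \<longlonglongrightarrow> y" by (rule tendsto_eventually)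
  qed
  have mean: "(\<integral>u. h u \<partial>\<mu>) = (\<integral>u. \<phi> u \<partial>\<mu>)"
    by (rule constant_seq[OF weak[OF bounded_measurable_const[of 1], simplified]]) (rule integral_avg[OF \<phi>])
  have h\<phi>: "(\<integral>u. h u * h u \<partial>\<mu>) = (\<integral>u. \<phi> u * h u \<partial>\<mu>)"
    by (rule constant_seq[OF weak[OF h]]) (rule integral_avg_mult_invariant[OF \<phi> h const])
  let ?c = "\<lambda>d. \<integral>u. \<phi> u * Kn d \<phi> u \<partial>\<mu>"
  have sm: "(\<integral>u. second_moment \<phi> n u \<partial>\<mu>) = (\<Sum>j=1..n. \<Sum>k=1..n. ?c (max j k - min j k))" for n
    unfolding second_moment_def
    by (simp add: Bochner_Integration.integral_sum integrable_stationary integral_Kn bounded_measurable_intros \<phi>)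
  have err: "(\<integral>u. (\<integral>\<omega>. (time_avg \<phi> n \<omega> - h u)\<^sup>2 \<partial>law u) \<partial>\<mu>)
    = (\<Sum>j=1..n. \<Sum>k=1..n. ?c (max j k - min j k)) / (real n)\<^sup>2
      - 2 * (\<integral>u. avg n \<phi> u * h u \<partial>\<mu>) + (\<integral>u. h u * h u \<partial>\<mu>)" for n
  proof -
    have "(\<integral>u. (\<integral>\<omega>. (time_avg \<phi> n \<omega> - h u)\<^sup>2 \<partial>law u) \<partial>\<mu>)
      = (\<integral>u. second_moment \<phi> n u / (real n)\<^sup>2 - 2 * (avg n \<phi> u * h u) + h u * h u \<partial>\<mu>)"
      unfolding integral_time_avg_error[OF \<phi>]
      by (rule arg_cong[where f="integral\<^sup>L \<mu>"]) (simp add: fun_eq_iff power2_eq_square)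
    also have "\<dots> = (\<integral>u. second_moment \<phi> n u \<partial>\<mu>) / (real n)\<^sup>2
      - 2 * (\<integral>u. avg n \<phi> u * h u \<partial>\<mu>) + (\<integral>u. h u * h u \<partial>\<mu>)"
      by (simp add: integrable_stationary bounded_measurable_intros \<phi> h)
    finally show ?thesis by (simp only: sm)
  qed
  have "(\<lambda>n. \<integral>u. (\<integral>\<omega>. (time_avg \<phi> n \<omega> - h u)\<^sup>2 \<partial>law u) \<partial>\<mu>)
    \<longlonglongrightarrow> (\<integral>u. h u * \<phi> u \<partial>\<mu>) - 2 * (\<integral>u. h u * h u \<partial>\<mu>) + (\<integral>u. h u * h u \<partial>\<mu>)"
    unfolding err by (intro tendsto_intros mean_square_correlation[OF \<phi> h lim] weak h)
  also have "(\<integral>u. h u * \<phi> u \<partial>\<mu>) - 2 * (\<integral>u. h u * h u \<partial>\<mu>) + (\<integral>u. h u * h u \<partial>\<mu>) = 0"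
    by (simp add: h\<phi> mult.commute)
  finally show thesis
    using that h const mean by blast
qed

text \<open>Summable mean-square errors force the errors to zero almost surely; the argument is used once over the
starting point \<open>u\<close> and once over the path.\<close>

lemma AE_time_avg_tendsto:
  assumes \<phi>: "bounded_measurable \<phi>" and h: "bounded_measurable h"
    and summable: "summable (\<lambda>j. \<integral>u. (\<integral>\<omega>. (time_avg \<phi> (r j) \<omega> - h u)\<^sup>2 \<partial>law u) \<partial>\<mu>)"
  shows "AE u in \<mu>. AE \<omega> in law u. (\<lambda>j. time_avg \<phi> (r j) \<omega>) \<longlonglongrightarrow> h u"
proof -
  have "bounded_measurable (\<lambda>u. \<integral>\<omega>. (time_avg \<phi> n \<omega> - h u)\<^sup>2 \<partial>law u)" for n
    unfolding integral_time_avg_error[OF \<phi>] by (intro bounded_measurable_intros \<phi> h)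
  then have "AE u in \<mu>. summable (\<lambda>j. \<integral>\<omega>. (time_avg \<phi> (r j) \<omega> - h u)\<^sup>2 \<partial>law u)"
    by (intro AE_summable_if_summable_integrals summable integrable_stationary) simp_all
  then show ?thesis
  proof eventually_elim
    case (elim u)
    have "AE \<omega> in law u. summable (\<lambda>j. (time_avg \<phi> (r j) \<omega> - h u)\<^sup>2)"
      by (intro AE_summable_if_summable_integrals elim integrable_time_avg_error \<phi>) simp_all
    then show ?case
    proof eventually_elim
      case (elim \<omega>)
      then have "(\<lambda>j. (time_avg \<phi> (r j) \<omega> - h u)\<^sup>2) \<longlonglongrightarrow> 0"
        by (rule summable_LIMSEQ_zero)
      then have "(\<lambda>j. time_avg \<phi> (r j) \<omega> - h u) \<longlonglongrightarrow> 0"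
        by (auto dest!: tendsto_real_sqrt simp: tendsto_rabs_zero_iff)
      then show ?case by (simp add: LIM_zero_iff)
    qed
  qed
qed

end

section \<open>Ergodicity\<close>

context stationary_chain begin

text \<open>The superlevel set of \<open>h\<close> at its mean is invariant, hence null or full. Either way \<open>h\<close> lies almost
everywhere on one side of its mean, so it equals its mean.\<close>

lemma ergodic_imp_constant:
  assumes erg: "ergodic_measure P \<mu>" and h: "bounded_measurable h"
    and const: "AE u in \<mu>. AE v in P u. h v = h u"
  shows "AE u in \<mu>. h u = (\<integral>u. h u \<partial>\<mu>)"
proof -
  define m where "m = (\<integral>u. h u \<partial>\<mu>)"
  define A where "A = {u. m < h u}"
  have [measurable]: "h \<in> borel_measurable borel" using h by (rule bounded_measurableD)
  have A[measurable]: "A \<in> sets borel"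
    unfolding A_def by measurable
  have "AE u in \<mu>. K (indicator A) u = indicator A u"
    using const
  proof eventually_elim
    case (elim u)
    interpret Pu: prob_space "P u" by (rule prob_space_kernel)
    have "(\<integral>v. indicator A v \<partial>P u) = (\<integral>v. (indicator A u :: real) \<partial>P u)"
    proof (rule integral_cong_AE)
      show "AE v in P u. indicator A v = (indicator A u :: real)"
        using elim by eventually_elim (simp add: A_def indicator_def)
    qed (auto intro: borel_measurable_integrable[OF integrable_kernel] bounded_measurable_indicator A)
    then show ?case by (simp add: kernel_op_def Pu.prob_space)
  qed
  with erg A have "prob A = 0 \<or> prob A = 1"
    unfolding ergodic_measure_def by blast
  then show ?thesis
  proof
    assume "prob A = 0"
    then have "AE u in \<mu>. u \<notin> A"
      by (subst (asm) prob_eq_0) auto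
    then have nn: "AE u in \<mu>. 0 \<le> m - h u"
      by eventually_elim (simp add: A_def)
    have "(\<integral>u. m - h u \<partial>\<mu>) = 0"
      by (simp add: integrable_stationary h m_def prob_UNIV)
    then have "AE u in \<mu>. m - h u = 0"
      using integral_nonneg_eq_0_iff_AE[OF integrable_stationary nn] by (simp add: bounded_measurable_intros h)
    then show ?thesis unfolding m_def[symmetric] by eventually_elim simp
  next
    assume "prob A = 1"
    then have "AE u in \<mu>. u \<in> A"
      by (subst (asm) prob_eq_1) auto
    then have nn: "AE u in \<mu>. 0 \<le> h u - m"
      by eventually_elim (simp add: A_def)
    have "(\<integral>u. h u - m \<partial>\<mu>) = 0"
      by (simp add: integrable_stationary h m_def prob_UNIV)
    then have "AE u in \<mu>. h u - m = 0"
      using integral_nonneg_eq_0_iff_AE[OF integrable_stationary nn] by (simp add: bounded_measurable_intros h)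
    then show ?thesis unfolding m_def[symmetric] by eventually_elim simp
  qed
qed

text \<open>Almost surely, the chain does not leave an invariant set \<open>A\<close> and does not enter it from outside, so
\<open>P u B\<close> restricted to \<open>u \<in> A\<close> is \<open>P u (A \<inter> B)\<close>.\<close>

lemma invariant_uniform_measure:
  assumes A: "A \<in> sets borel" and inv: "AE u in \<mu>. K (indicator A) u = indicator A u"
    and pos: "prob A \<noteq> 0"
  shows "invariant_measure P (uniform_measure \<mu> A)"
  unfolding invariant_measure_def
proof
  have pos': "emeasure \<mu> A \<noteq> 0" "emeasure \<mu> A \<noteq> \<infinity>"
    using pos by (simp_all add: emeasure_eq_measure)
  have [measurable]: "A \<in> sets borel" by (rule A)
  show U: "uniform_measure \<mu> A \<in> space (prob_algebra borel)"
    using prob_space_uniform_measure[OF pos'] by (simp add: space_prob_algebra)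
  have ne: "space (uniform_measure \<mu> A) \<noteq> {}" "space \<mu> \<noteq> {}" by simp_all
  have sU: "sets (uniform_measure \<mu> A) = sets borel" by simp
  have P\<mu>: "P \<in> \<mu> \<rightarrow>\<^sub>M subprob_algebra borel" "P \<in> uniform_measure \<mu> A \<rightarrow>\<^sub>M subprob_algebra borel"
    unfolding measurable_cong_sets[OF sets_\<mu> refl] measurable_cong_sets[OF sU refl]
    by (rule measurable_kernel)+
  show "uniform_measure \<mu> A \<bind> P = uniform_measure \<mu> A"
  proof (rule measure_eqI)
    show sets: "sets (uniform_measure \<mu> A \<bind> P) = sets (uniform_measure \<mu> A)"
      unfolding sU by (rule sets_bind[OF sets_kernel[OF P\<mu>(2)] ne(1)])
    fix B assume "B \<in> sets (uniform_measure \<mu> A \<bind> P)"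
    then have B[measurable]: "B \<in> sets borel" using sets by simp
    have "emeasure (uniform_measure \<mu> A \<bind> P) B = (\<integral>\<^sup>+u. emeasure (P u) B \<partial>uniform_measure \<mu> A)"
      by (rule emeasure_bind[OF ne(1) P\<mu>(2) B])
    also have "\<dots> = (\<integral>\<^sup>+u. emeasure (P u) B * indicator A u \<partial>\<mu>) / emeasure \<mu> A"
    proof (rule nn_integral_uniform_measure)
      show "(\<lambda>u. emeasure (P u) B) \<in> borel_measurable \<mu>"
        by (rule measurable_compose[OF P\<mu>(1) measurable_emeasure_subprob_algebra[OF B]])
    qed (simp add: A)
    also have "(\<integral>\<^sup>+u. emeasure (P u) B * indicator A u \<partial>\<mu>) = (\<integral>\<^sup>+u. emeasure (P u) (A \<inter> B) \<partial>\<mu>)"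
    proof (rule nn_integral_cong_AE)
      show "AE u in \<mu>. emeasure (P u) B * indicator A u = emeasure (P u) (A \<inter> B)"
        using inv
      proof eventually_elim
        case (elim u)
        interpret Pu: prob_space "P u" by (rule prob_space_kernel)
        have sP: "sets (P u) = sets borel"
          using kernel_in_prob_algebra[of u] by (simp add: space_prob_algebra)
        have PA: "Pu.prob A = indicator A u"
          using elim by (simp add: kernel_op_def sP sets_eq_imp_space_eq[OF sP])
        show ?case
        proof (cases "u \<in> A")
          case True
          then have "AE v in P u. v \<in> A"
            using PA by (subst Pu.prob_eq_1[symmetric]) (auto simp: sP)
          then have "emeasure (P u) B = emeasure (P u) (A \<inter> B)"
            by (intro emeasure_eq_AE) (auto simp: sP elim: eventually_mono)
          with True show ?thesis by simp
        next
          case False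
          then have "emeasure (P u) A = 0"
            using PA by (simp add: Pu.emeasure_eq_measure)
          then have "emeasure (P u) (A \<inter> B) = 0"
            using emeasure_mono[of "A \<inter> B" A "P u"] by (simp add: sP)
          with False show ?thesis by simp
        qed
      qed
    qed
    also have "\<dots> = emeasure (\<mu> \<bind> P) (A \<inter> B)"
      by (rule emeasure_bind[OF ne(2) P\<mu>(1), symmetric]) simp
    also have "\<mu> \<bind> P = \<mu>" using invariant by (simp add: invariant_measure_def)
    also have "emeasure \<mu> (A \<inter> B) / emeasure \<mu> A = emeasure (uniform_measure \<mu> A) B"
      by (rule emeasure_uniform_measure[symmetric]) simp_all
    finally show "emeasure (uniform_measure \<mu> A \<bind> P) B = emeasure (uniform_measure \<mu> A) B" .
  qed
qed

lemma unique_invariant_imp_ergodic: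
  assumes unique: "\<And>\<nu>. invariant_measure P \<nu> \<Longrightarrow> \<nu> = \<mu>"
  shows "ergodic_measure P \<mu>"
  unfolding ergodic_measure_def
proof (intro conjI ballI impI invariant)
  fix A assume A: "A \<in> sets borel" and inv: "AE u in \<mu>. K (indicator A) u = indicator A u"
  show "prob A \<in> {0, 1}"
  proof (cases "prob A = 0")
    case False
    then have pos: "emeasure \<mu> A \<noteq> 0" "emeasure \<mu> A \<noteq> \<infinity>"
      by (simp_all add: emeasure_eq_measure)
    have "uniform_measure \<mu> A = \<mu>"
      by (intro unique invariant_uniform_measure A inv False)
    with emeasure_uniform_measure_1[OF pos] have "emeasure \<mu> A = 1" by simp
    then show ?thesis by (simp add: measure_def)
  qed simp
qed

end

section \<open>Generalized couplings and uniqueness\<close>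

text \<open>Almost sure limits survive the passage to absolutely continuous marginals, so under \<open>\<Gamma>\<close> the difference of
the two averages tends to \<open>a - b\<close> along \<open>r\<close> almost surely; on a set of positive measure it tends to \<open>0\<close>.\<close>

lemma gen_coupling_imp_eq_limits:
  assumes \<Gamma>: "\<Gamma> \<in> gen_couplings M1 M2" and sets: "sets M1 = sets seq_space" "sets M2 = sets seq_space"
    and pos: "measure \<Gamma> (avg_agree_set \<phi>) > 0" and r: "strict_mono r"
    and lim1: "AE \<omega> in M1. (\<lambda>j. time_avg \<phi> (r j) \<omega>) \<longlonglongrightarrow> a"
    and lim2: "AE \<omega> in M2. (\<lambda>j. time_avg \<phi> (r j) \<omega>) \<longlonglongrightarrow> b"
  shows "a = b"
proof (rule ccontr)
  assume "a \<noteq> b"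
  have s\<Gamma>: "sets \<Gamma> = sets (seq_space \<Otimes>\<^sub>M seq_space)"
    and ac: "absolutely_continuous M1 (distr \<Gamma> seq_space fst)"
      "absolutely_continuous M2 (distr \<Gamma> seq_space snd)"
    using \<Gamma> by (simp_all add: gen_couplings_def space_prob_algebra)
  have fst: "fst \<in> \<Gamma> \<rightarrow>\<^sub>M seq_space" and snd: "snd \<in> \<Gamma> \<rightarrow>\<^sub>M seq_space"
    unfolding measurable_cong_sets[OF s\<Gamma> refl] by simp_all
  have "AE x in \<Gamma>. (\<lambda>j. time_avg \<phi> (r j) (fst x)) \<longlonglongrightarrow> a"
    by (rule AE_distrD[OF fst absolutely_continuous_AE[OF _ ac(1) lim1]]) (simp add: sets)
  moreover have "AE x in \<Gamma>. (\<lambda>j. time_avg \<phi> (r j) (snd x)) \<longlonglongrightarrow> b"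
    by (rule AE_distrD[OF snd absolutely_continuous_AE[OF _ ac(2) lim2]]) (simp add: sets)
  ultimately have "AE x in \<Gamma>. x \<notin> avg_agree_set \<phi>"
  proof eventually_elim
    case (elim x)
    show ?case
    proof
      assume "x \<in> avg_agree_set \<phi>"
      then have "(\<lambda>n. (1 / real n) * (\<Sum>k=1..n. \<phi> (fst x k) - \<phi> (snd x k))) \<longlonglongrightarrow> 0"
        by (auto simp: avg_agree_set_def split: prod.splits)
      then have "(\<lambda>n. time_avg \<phi> n (fst x) - time_avg \<phi> n (snd x)) \<longlonglongrightarrow> 0"
        by (simp add: time_avg_def sum_subtractf diff_divide_distrib)
      from LIMSEQ_subseq_LIMSEQ[OF this r]
      have "(\<lambda>j. time_avg \<phi> (r j) (fst x) - time_avg \<phi> (r j) (snd x)) \<longlonglongrightarrow> 0"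
        by (simp add: comp_def)
      from LIMSEQ_unique[OF this tendsto_diff[OF elim]] \<open>a \<noteq> b\<close> show False by simp
    qed
  qed
  moreover have "avg_agree_set \<phi> \<in> sets \<Gamma>"
    using pos measure_notin_sets by fastforce
  ultimately have "avg_agree_set \<phi> \<in> null_sets \<Gamma>"
    by (simp add: AE_iff_null_sets)
  then show False using pos by (simp add: measure_eq_0_null_sets)
qed

text \<open>Only one subsequence may be used for both chains, since the coupling controls the two averages at equal
times; hence \<open>r\<close> is chosen after the mean-square limits for both measures are known.\<close>

lemma coupled_invariant_measures_limits_agree:
  fixes P :: "'a::topological_space \<Rightarrow> 'a measure"
  assumes "stationary_chain P \<mu>1" "stationary_chain P \<mu>2"
    and \<phi>: "bounded_measurable \<phi>"
    and coupling: "\<And>u v. u \<in> H0 \<Longrightarrow> v \<in> H0 \<Longrightarrow>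
      \<exists>\<Gamma>\<in>gen_couplings (chain_law (return borel u) P) (chain_law (return borel v) P).
        measure \<Gamma> (avg_agree_set \<phi>) > 0"
  obtains h1 h2 where
    "bounded_measurable h1" "AE u in \<mu>1. AE v in P u. h1 v = h1 u" "(\<integral>u. h1 u \<partial>\<mu>1) = (\<integral>u. \<phi> u \<partial>\<mu>1)"
    "bounded_measurable h2" "AE u in \<mu>2. AE v in P u. h2 v = h2 u" "(\<integral>u. h2 u \<partial>\<mu>2) = (\<integral>u. \<phi> u \<partial>\<mu>2)"
    "AE u in \<mu>1. AE v in \<mu>2. u \<in> H0 \<longrightarrow> v \<in> H0 \<longrightarrow> h1 u = h2 v"
proof -
  interpret S1: stationary_chain P \<mu>1 by fact
  interpret S2: stationary_chain P \<mu>2 by fact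
  obtain h1 where h1: "bounded_measurable h1" "AE u in \<mu>1. AE v in P u. h1 v = h1 u"
      "(\<integral>u. h1 u \<partial>\<mu>1) = (\<integral>u. \<phi> u \<partial>\<mu>1)"
    and lim1: "(\<lambda>n. \<integral>u. (\<integral>\<omega>. (time_avg \<phi> n \<omega> - h1 u)\<^sup>2 \<partial>S1.law u) \<partial>\<mu>1) \<longlonglongrightarrow> 0"
    using S1.time_avg_mean_square_limit[OF \<phi>] by blast
  obtain h2 where h2: "bounded_measurable h2" "AE u in \<mu>2. AE v in P u. h2 v = h2 u"
      "(\<integral>u. h2 u \<partial>\<mu>2) = (\<integral>u. \<phi> u \<partial>\<mu>2)"
    and lim2: "(\<lambda>n. \<integral>u. (\<integral>\<omega>. (time_avg \<phi> n \<omega> - h2 u)\<^sup>2 \<partial>S1.law u) \<partial>\<mu>2) \<longlonglongrightarrow> 0"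
    using S2.time_avg_mean_square_limit[OF \<phi>] by blast
  let ?e1 = "\<lambda>n. \<integral>u. (\<integral>\<omega>. (time_avg \<phi> n \<omega> - h1 u)\<^sup>2 \<partial>S1.law u) \<partial>\<mu>1"
  let ?e2 = "\<lambda>n. \<integral>u. (\<integral>\<omega>. (time_avg \<phi> n \<omega> - h2 u)\<^sup>2 \<partial>S1.law u) \<partial>\<mu>2"
  have "\<exists>N. \<forall>n\<ge>N. ?e1 n < (1/2) ^ j \<and> ?e2 n < (1/2) ^ j" for j :: nat
    using eventually_conj[OF order_tendstoD(2)[OF lim1, of "(1/2) ^ j"] order_tendstoD(2)[OF lim2, of "(1/2) ^ j"]]
    by (simp add: eventually_sequentially)
  then obtain r :: "nat \<Rightarrow> nat" where r: "strict_mono r"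
    and small: "\<And>j. ?e1 (r j) < (1/2) ^ j \<and> ?e2 (r j) < (1/2) ^ j"
    using subsequence_choice[of "\<lambda>j n. ?e1 n < (1/2) ^ j \<and> ?e2 n < (1/2) ^ j"] by blast
  have summable: "summable (\<lambda>j. ?e1 (r j))" "summable (\<lambda>j. ?e2 (r j))"
    by (rule summable_comparison_test'[OF summable_geometric[of "1/2"], of 0];
        use small in \<open>auto simp: less_imp_le\<close>)+
  have "AE u in \<mu>1. AE v in \<mu>2. u \<in> H0 \<longrightarrow> v \<in> H0 \<longrightarrow> h1 u = h2 v"
    using S1.AE_time_avg_tendsto[OF \<phi> h1(1) summable(1)]
  proof eventually_elim
    case lim_u: (elim u)
    show ?case
      using S2.AE_time_avg_tendsto[OF \<phi> h2(1) summable(2)]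
    proof eventually_elim
      case lim_v: (elim v)
      show ?case
      proof (intro impI)
        assume "u \<in> H0" "v \<in> H0"
        from coupling[OF this] show "h1 u = h2 v"
          using gen_coupling_imp_eq_limits[OF _ _ _ _ r lim_u lim_v] by auto
      qed
    qed
  qed
  with h1 h2 show thesis by (rule that)
qed

theorem theorem2p1:
  fixes P :: "'a::polish_space \<Rightarrow> 'a measure"
    and G :: "('a \<Rightarrow> real) set"
    and H0 :: "'a set"
  assumes "markov_kernel P"
    and "\<forall>\<phi>\<in>G. bounded_measurable \<phi>"
    and "determines_measures G"
    and "H0 \<in> sets borel"
    and "\<forall>u0\<in>H0. \<forall>v0\<in>H0. \<forall>\<phi>\<in>G.
           \<exists>\<Gamma>\<in>gen_couplings (chain_law (return borel u0) P) (chain_law (return borel v0) P).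
             measure \<Gamma> (avg_agree_set \<phi>) > 0"
  shows "(\<exists>\<^sub>\<le>\<^sub>1\<mu>. ergodic_measure P \<mu> \<and> measure \<mu> H0 > 0) \<and>
         (H0 = UNIV \<longrightarrow>
            (\<exists>\<^sub>\<le>\<^sub>1\<mu>. invariant_measure P \<mu>) \<and>
            (\<forall>\<mu>. invariant_measure P \<mu> \<longrightarrow> ergodic_measure P \<mu>))"
proof -
  have stationary: "stationary_chain P \<mu>" if "invariant_measure P \<mu>" for \<mu>
    using assms(1) that by (simp add: stationary_chain_def markov_chain_def stationary_chain_axioms_def)
  have determined: "\<mu>1 = \<mu>2"
    if inv: "invariant_measure P \<mu>1" "invariant_measure P \<mu>2"
      and eq: "\<And>\<phi>. \<phi> \<in> G \<Longrightarrow> (\<integral>u. \<phi> u \<partial>\<mu>1) = (\<integral>u. \<phi> u \<partial>\<mu>2)" for \<mu>1 \<mu>2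
    using assms(3) inv eq unfolding determines_measures_def invariant_measure_def by blast
  have coupling: "\<exists>\<Gamma>\<in>gen_couplings (chain_law (return borel u) P) (chain_law (return borel v) P).
      measure \<Gamma> (avg_agree_set \<phi>) > 0" if "\<phi> \<in> G" "u \<in> H0" "v \<in> H0" for \<phi> u v
    using assms(5) that by blast
  have ergodic_unique: "\<mu>1 = \<mu>2"
    if erg: "ergodic_measure P \<mu>1" "ergodic_measure P \<mu>2" and pos: "measure \<mu>1 H0 > 0" "measure \<mu>2 H0 > 0"
    for \<mu>1 \<mu>2
  proof (rule determined)
    show inv: "invariant_measure P \<mu>1" "invariant_measure P \<mu>2"
      using erg by (auto simp: ergodic_measure_def)
    interpret S1: stationary_chain P \<mu>1 by (rule stationary[OF inv(1)])
    interpret S2: stationary_chain P \<mu>2 by (rule stationary[OF inv(2)])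
    fix \<phi> assume \<phi>: "\<phi> \<in> G"
    then have bm_\<phi>: "bounded_measurable \<phi>" using assms(2) by blast
    obtain h1 h2 where h1: "bounded_measurable h1" "AE u in \<mu>1. AE v in P u. h1 v = h1 u" "(\<integral>u. h1 u \<partial>\<mu>1) = (\<integral>u. \<phi> u \<partial>\<mu>1)"
      and h2: "bounded_measurable h2" "AE u in \<mu>2. AE v in P u. h2 v = h2 u" "(\<integral>u. h2 u \<partial>\<mu>2) = (\<integral>u. \<phi> u \<partial>\<mu>2)"
      and agree: "AE u in \<mu>1. AE v in \<mu>2. u \<in> H0 \<longrightarrow> v \<in> H0 \<longrightarrow> h1 u = h2 v"
      by (rule coupled_invariant_measures_limits_agree[OF S1.stationary_chain_axioms S2.stationary_chain_axioms
            bm_\<phi> coupling[OF \<phi>]])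
    show "(\<integral>u. \<phi> u \<partial>\<mu>1) = (\<integral>u. \<phi> u \<partial>\<mu>2)"
    proof (rule ccontr)
      assume neq: "(\<integral>u. \<phi> u \<partial>\<mu>1) \<noteq> (\<integral>u. \<phi> u \<partial>\<mu>2)"
      have not_null: "\<not> (AE v in \<mu>2. v \<notin> H0)" "\<not> (AE v in \<mu>1. v \<notin> H0)"
        using pos S1.prob_eq_0[of H0] S2.prob_eq_0[of H0] assms(4) by auto
      \<comment> \<open>The two constants differ, so almost no pair \<open>(u, v)\<close> can lie in \<open>H0 \<times> H0\<close>.\<close>
      have "AE u in \<mu>1. u \<notin> H0"
        using agree S1.ergodic_imp_constant[OF erg(1) h1(1,2)]
      proof eventually_elim
        case (elim u)
        show ?case
        proof
          assume "u \<in> H0"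
          have "AE v in \<mu>2. v \<notin> H0"
            using elim(1) S2.ergodic_imp_constant[OF erg(2) h2(1,2)]
            by eventually_elim (use \<open>u \<in> H0\<close> elim(2) neq h1(3) h2(3) in auto)
          with not_null(1) show False by blast
        qed
      qed
      with not_null(2) show False by blast
    qed
  qed
  have invariant_unique: "\<mu>1 = \<mu>2"
    if H0: "H0 = UNIV" and inv: "invariant_measure P \<mu>1" "invariant_measure P \<mu>2" for \<mu>1 \<mu>2
  proof (rule determined[OF inv])
    interpret S1: stationary_chain P \<mu>1 by (rule stationary[OF inv(1)])
    interpret S2: stationary_chain P \<mu>2 by (rule stationary[OF inv(2)])
    fix \<phi> assume \<phi>: "\<phi> \<in> G"
    then have bm_\<phi>: "bounded_measurable \<phi>" using assms(2) by blast
    obtain h1 h2 where h1: "bounded_measurable h1" "AE u in \<mu>1. AE v in P u. h1 v = h1 u" "(\<integral>u. h1 u \<partial>\<mu>1) = (\<integral>u. \<phi> u \<partial>\<mu>1)"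
      and h2: "bounded_measurable h2" "AE u in \<mu>2. AE v in P u. h2 v = h2 u" "(\<integral>u. h2 u \<partial>\<mu>2) = (\<integral>u. \<phi> u \<partial>\<mu>2)"
      and agree: "AE u in \<mu>1. AE v in \<mu>2. u \<in> H0 \<longrightarrow> v \<in> H0 \<longrightarrow> h1 u = h2 v"
      by (rule coupled_invariant_measures_limits_agree[OF S1.stationary_chain_axioms S2.stationary_chain_axioms
            bm_\<phi> coupling[OF \<phi>]])
    \<comment> \<open>For a fixed good \<open>u\<close>, integrate \<open>h1 u = h2 v\<close> over \<open>v\<close>.\<close>
    have "AE u in \<mu>1. h1 u = (\<integral>v. h2 v \<partial>\<mu>2)"
      using agree
    proof eventually_elim
      case (elim u)
      have "(\<integral>v. h2 v \<partial>\<mu>2) = (\<integral>v. h1 u \<partial>\<mu>2)"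
        using elim by (intro integral_cong_AE) (auto intro: S2.measurable_stationary h2 simp: H0)
      then show ?case by (simp add: S2.prob_UNIV)
    qed
    then have "(\<integral>u. h1 u \<partial>\<mu>1) = (\<integral>u. (\<integral>v. h2 v \<partial>\<mu>2) \<partial>\<mu>1)"
      by (intro integral_cong_AE) (auto intro: S1.measurable_stationary h1)
    then show "(\<integral>u. \<phi> u \<partial>\<mu>1) = (\<integral>u. \<phi> u \<partial>\<mu>2)"
      using h1(3) h2(3) by (simp add: S1.prob_UNIV)
  qed
  show ?thesis
  proof (intro conjI impI allI)
    show "\<exists>\<^sub>\<le>\<^sub>1\<mu>. ergodic_measure P \<mu> \<and> measure \<mu> H0 > 0"
      by (rule Uniq_I) (use ergodic_unique in blast)
    assume H0: "H0 = UNIV"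
    show "\<exists>\<^sub>\<le>\<^sub>1\<mu>. invariant_measure P \<mu>"
      by (rule Uniq_I) (use invariant_unique H0 in blast)
    fix \<mu> assume "invariant_measure P \<mu>"
    then show "ergodic_measure P \<mu>"
      by (intro stationary_chain.unique_invariant_imp_ergodic stationary invariant_unique H0)
  qed
qed

end
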